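(* Let $\chi$ be an inner function in $\mathbb{C}_+$ and let $\phi:\mathbb{C}_+\to\mathbb{C}_+$ be an analytic function. Consider the composition operator $C_\phi: H(\chi)\to H^2(\mathbb{C}_+)$, $C_\phi f=f\circ\phi$. Then the following hold. (1) If $C_\phi$ is bounded, then $$\sup_{z\in\mathbb{C}_+}\frac{\Im(z)}{\Im(\phi(z))}\left[1-|\chi(\phi(z))|^2\right]<\infty .$$ (2) If $$\sup_{z\in\mathbb{C}_+}\frac{\Im(z)}{\Im(\phi(z))}<\infty ,$$ then $C_\phi$ is bounded. Moreover, if $\chi$ and $\phi$ are such that $\sup_{z\in\mathbb{C}_+}|\chi(\phi(z))|<1$, then $C_\phi: H(\chi)\to H^2(\mathbb{C}_+)$ is bounded if and only if $\sup_{z\in\mathbb{C}_+}\frac{\Im(z)}{\Im(\phi(z))}<\infty$.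
   Context: $\mathbb{C}_+$ is the open upper half-plane and $H^2(\mathbb{C}_+)$ is the Hardy Hilbert space on $\mathbb{C}_+$, with norm given by the $L^2(\mathbb{R})$ norm of boundary values. An analytic function $\chi$ on $\mathbb{C}_+$ is inner if $|\chi(z)|\le 1$ for all $z\in\mathbb{C}_+$ and $|\chi(x)|=1$ for a.e. $x\in\mathbb{R}$ (boundary values). The model space associated with $\chi$ is $H(\chi):=H^2(\mathbb{C}_+)\ominus\chi H^2(\mathbb{C}_+)$, the orthogonal complement of $\chi H^2(\mathbb{C}_+)$ in $H^2(\mathbb{C}_+)$, with the inherited norm. Saying that $C_\phi: H(\chi)\to H^2(\mathbb{C}_+)$ is bounded means that $f\circ\phi\in H^2(\mathbb{C}_+)$ for all $f\in H(\chi)$ and $\|f\circ\phi\|\le M\|f\|$ for some constant $M$. *)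

theory Defs
  imports "HOL-Complex_Analysis.Complex_Analysis"
begin

text \<open>
  Functions on the upper half-plane are represented as total functions on the complex plane.
  Every notion below depends only on their values on the half-plane.
\<close>

definition upper_half_plane :: "complex set" where
  "upper_half_plane = {z. Im z > 0}"

text \<open>
  The filter of non-tangential approach to the real point \<open>x\<close>: a function tends to \<open>l\<close> along it
  iff, for every aperture \<open>a > 0\<close>, it tends to \<open>l\<close> within the cone \<open>\<bar>Re z - x\<bar> < a Im z\<close>.
  That inequality already forces \<open>Im z > 0\<close>.
\<close>

definition nontangential :: "real \<Rightarrow> complex filter" where
  "nontangential x = (SUP a\<in>{0<..}. at (of_real x) within {z. \<bar>Re z - x\<bar> < a * Im z})"

lemma tendsto_nontangential_iff:
  fixes f :: "complex \<Rightarrow> complex"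
  shows "(f \<longlongrightarrow> l) (nontangential x) \<longleftrightarrow>
    (\<forall>a>0. (f \<longlongrightarrow> l) (at (of_real x) within {z. \<bar>Re z - x\<bar> < a * Im z}))"
  unfolding nontangential_def tendsto_def eventually_Sup by auto

lemma nontangential_neq_bot: "nontangential x \<noteq> bot"
proof -
  define S where "S = {z::complex. \<bar>Re z - x\<bar> < 1 * Im z}"
  have "of_real x islimpt S"
    unfolding islimpt_approachable
  proof (intro allI impI)
    fix e :: real
    assume e: "e > 0"
    have "Complex x (e / 2) \<in> S" "Complex x (e / 2) \<noteq> of_real x"
      using e by (auto simp: S_def complex_eq_iff)
    moreover have "dist (Complex x (e / 2)) (of_real x) < e"
      using e by (simp add: dist_norm complex_norm complex_eq_iff cmod_def)
    ultimately show "\<exists>z\<in>S. z \<noteq> of_real x \<and> dist z (of_real x) < e" by blast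
  qed
  hence "at (of_real x) within S \<noteq> bot"
    by (simp add: trivial_limit_within)
  moreover have "at (of_real x) within S \<le> nontangential x"
    unfolding nontangential_def S_def by (rule SUP_upper) auto
  ultimately show ?thesis
    by (metis bot.extremum_uniqueI)
qed

text \<open>Meaningful only where the limit exists; for functions in \<open>H\<^sup>2\<close> or bounded analytic functions
  this is almost everywhere, by Fatou's theorem.\<close>

definition boundary_value :: "(complex \<Rightarrow> complex) \<Rightarrow> real \<Rightarrow> complex" where
  "boundary_value f x = Lim (nontangential x) f"

definition hardy2 :: "(complex \<Rightarrow> complex) set" where
  "hardy2 = {f. f holomorphic_on upper_half_plane \<and>
     (SUP y\<in>{0<..}. \<integral>\<^sup>+x. ennreal ((cmod (f (Complex x y)))\<^sup>2) \<partial>lebesgue) < \<infinity>}"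

definition hardy2_inner :: "(complex \<Rightarrow> complex) \<Rightarrow> (complex \<Rightarrow> complex) \<Rightarrow> complex" where
  "hardy2_inner f g = (LINT x|lebesgue. boundary_value f x * cnj (boundary_value g x))"

definition hardy2_norm :: "(complex \<Rightarrow> complex) \<Rightarrow> real" where
  "hardy2_norm f = sqrt (LINT x|lebesgue. (cmod (boundary_value f x))\<^sup>2)"

definition inner_function :: "(complex \<Rightarrow> complex) \<Rightarrow> bool" where
  "inner_function chi \<longleftrightarrow>
     chi holomorphic_on upper_half_plane \<and>
     (\<forall>z\<in>upper_half_plane. cmod (chi z) \<le> 1) \<and>
     (AE x in lebesgue. \<exists>l. (chi \<longlongrightarrow> l) (nontangential x) \<and> cmod l = 1)"

definition model_space :: "(complex \<Rightarrow> complex) \<Rightarrow> (complex \<Rightarrow> complex) set" where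
  "model_space chi = {f \<in> hardy2. \<forall>h\<in>hardy2. hardy2_inner f (\<lambda>z. chi z * h z) = 0}"

definition bounded_composition :: "(complex \<Rightarrow> complex) \<Rightarrow> (complex \<Rightarrow> complex) \<Rightarrow> bool" where
  "bounded_composition chi \<phi> \<longleftrightarrow>
     (\<forall>f\<in>model_space chi. f \<circ> \<phi> \<in> hardy2) \<and>
     (\<exists>M. \<forall>f\<in>model_space chi. hardy2_norm (f \<circ> \<phi>) \<le> M * hardy2_norm f)"

end

theory Submission
  imports Defs
begin

text \<open>
  Everything follows from one fact about a Hardy function \<open>f\<close> (lemma \<open>hardy2_boundary_function\<close>): it has
  non-tangential boundary values almost everywhere, these are square integrable with norm at most the
  supremum over horizontal lines, and \<open>f\<close> is their Poisson integral.
  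
  Granting this, suppose that the composition operator is bounded. Apply it to the reproducing kernel of the
  model space at \<open>\<phi> z\<close> and evaluate the result at \<open>z\<close>: point evaluation at \<open>z\<close> costs a factor of order
  \<open>1 / sqrt (Im z)\<close> (\<open>hardy2_point_evaluation\<close>), while value and norm of the kernel are explicit
  (\<open>model_kernel_norm\<close>). The resulting inequality is the one asserted
  (\<open>bounded_composition_imp_kernel_ratio_bounded\<close>). That the kernel lies in the model space
  amounts to the vanishing of an integral, which is seen by moving the line of integration upwards (\<open>model_kernel_orthogonal\<close>).
  
  Conversely, let \<open>Im z \<le> C * Im (\<phi> z)\<close>. By Jensen's inequality \<open>(cmod (f w))\<^sup>2\<close> is at most the Poisson integral
  at \<open>w\<close> of the squared boundary values of \<open>f\<close>. Along the curve \<open>w = \<phi> (x + \<i> * y)\<close> the Poisson kernel has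
  total mass at most \<open>C\<close> in the variable \<open>x\<close> (\<open>nn_integral_poisson_composed\<close>), so Tonelli's theorem bounds
  the composition on all Hardy functions (\<open>hardy2_composition\<close>). If \<open>cmod (chi (\<phi> z))\<close> stays away from one, the
  two conditions on the ratio of imaginary parts are equivalent.
  
  The fact about boundary values is proved as follows. Poisson averaging is a symmetric semigroup
  that moves a Hardy function from one horizontal line to a higher one. Hence the inner product of two
  slices depends only on the sum of their heights, their squared norm is a bounded convex function of
  the height, and the slices form a Cauchy family in \<open>L2\<close> as the height tends to zero (\<open>hardy2_slices_cauchy\<close>).
  The maximal inequality (\<open>poisson_maximal_inequality\<close>) turns this into smallness, off small sets, of the
  oscillation of \<open>f\<close> in cones (\<open>hardy2_small_nontangential_oscillation\<close>).
\<close>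

section \<open>The Poisson formula for bounded functions\<close>

text \<open>
  The factor \<open>1 / pi\<close> makes the kernel a probability density in its real variable.
\<close>

definition poisson :: "complex \<Rightarrow> real \<Rightarrow> real" where
  "poisson z t = Im z / (pi * (cmod (of_real t - z))\<^sup>2)"

lemma cmod_real_diff_sq: "(cmod (of_real t - z))\<^sup>2 = (t - Re z)\<^sup>2 + (Im z)\<^sup>2"
  by (simp add: cmod_power2)

lemma real_neq_upper: "Im z > 0 \<Longrightarrow> of_real t - z \<noteq> 0"
  by (auto simp: complex_eq_iff)

lemma poisson_nonneg: "Im z > 0 \<Longrightarrow> 0 \<le> poisson z t"
  by (simp add: poisson_def)

lemma poisson_le: "Im z > 0 \<Longrightarrow> poisson z t \<le> 1 / (pi * Im z)"
proof -
  assume z: "Im z > 0"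
  have "poisson z t \<le> Im z / (pi * (Im z)\<^sup>2)"
    unfolding poisson_def using z by (intro divide_left_mono mult_left_mono) (auto simp: cmod_real_diff_sq intro!: mult_pos_pos add_nonneg_pos)
  also have "\<dots> = 1 / (pi * Im z)" using z by (simp add: power2_eq_square)
  finally show ?thesis .
qed

lemma continuous_poisson: "Im z > 0 \<Longrightarrow> continuous_on UNIV (poisson z)"
  unfolding poisson_def by (intro continuous_intros) (auto dest: real_neq_upper)

lemma borel_measurable_poisson [measurable]: "Im z > 0 \<Longrightarrow> poisson z \<in> borel_measurable borel"
  by (intro borel_measurable_continuous_onI continuous_poisson)

lemma poisson_swap: "poisson (Complex x s) t = poisson (Complex t s) x"
  by (simp add: poisson_def cmod_real_diff_sq power2_commute)

text \<open>
  This is how the kernel enters at the end: composed with \<open>\<phi>\<close> it is still the imaginary part of a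
  holomorphic function, to which the Poisson formula applies again.
\<close>

lemma poisson_as_Im: "poisson z t = Im (1 / (of_real t - z)) / pi"
  by (simp add: poisson_def Im_divide cmod_real_diff_sq)

lemma has_bochner_integral_poisson:
  assumes z: "Im z > 0"
  shows "has_bochner_integral lborel (poisson z) 1"
proof -
  define F where "F t = arctan ((t - Re z) / Im z) / pi" for t
  have D: "DERIV F t :> poisson z t" for t
    unfolding F_def poisson_def cmod_real_diff_sq using z
    by (auto intro!: derivative_eq_intros simp: power2_eq_square divide_simps add_nonneg_eq_0_iff)
  have "filterlim (\<lambda>t. (t - Re z) / Im z) at_top at_top"
    using z by real_asymp
  then have T: "(F \<longlongrightarrow> 1/2) at_top"
    unfolding F_def using tendsto_divide[OF filterlim_compose[OF tendsto_arctan_at_top] tendsto_const[of pi]] by fastforce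
  have "filterlim (\<lambda>t. (t - Re z) / Im z) at_bot at_bot"
    using z by real_asymp
  then have B: "(F \<longlongrightarrow> -(1/2)) at_bot"
    unfolding F_def using tendsto_divide[OF filterlim_compose[OF tendsto_arctan_at_bot] tendsto_const[of pi]] by fastforce
  have *: "set_integrable lborel (einterval (-\<infinity>) \<infinity>) (poisson z)"
    "(LBINT x=-\<infinity>..\<infinity>. poisson z x) = 1/2 - (-(1/2))"
    using continuous_poisson[OF z] T B D
    by (rule_tac interval_integral_FTC_nonneg[where F=F and A="-(1/2)" and B="1/2"];
        simp add: poisson_nonneg[OF z] ereal_tendsto_simps continuous_on_eq_continuous_at)+
  then have "integrable lborel (poisson z)" "integral\<^sup>L lborel (poisson z) = 1"
    by (simp_all add: set_integrable_def interval_integral_to_infinity_eq interval_lebesgue_integral_def set_lebesgue_integral_def)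
  then show ?thesis by (simp add: has_bochner_integral_iff)
qed

lemma integrable_poisson: "Im z > 0 \<Longrightarrow> integrable lborel (poisson z)"
  and integral_poisson: "Im z > 0 \<Longrightarrow> integral\<^sup>L lborel (poisson z) = 1"
  using has_bochner_integral_poisson by (auto simp: has_bochner_integral_iff)

lemma nn_integral_poisson: "Im z > 0 \<Longrightarrow> (\<integral>\<^sup>+t. ennreal (poisson z t) \<partial>lborel) = 1"
  by (simp add: nn_integral_eq_integral integrable_poisson integral_poisson poisson_nonneg)

text \<open>
  Cauchy's theorem on the half-disc of radius \<open>R\<close>: by the quadratic decay the semicircle contributes
  \<open>O(1 / R)\<close>, so the integrals over \<open>[-R, R]\<close> tend to zero.
\<close>

lemma integral_real_line_zero:
  fixes G :: "complex \<Rightarrow> complex"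
  assumes hol: "G holomorphic_on {z. Im z > -d}" and d: "d > 0"
    and decay: "\<And>w. Im w \<ge> 0 \<Longrightarrow> cmod w \<ge> r \<Longrightarrow> cmod (G w) \<le> K / (cmod w)\<^sup>2"
    and int: "integrable lborel (\<lambda>t. G (of_real t))"
  shows "(LINT t|lborel. G (of_real t)) = 0"
proof -
  have S: "convex {z. Im z > -d}" by (rule convex_halfspace_Im_gt)
  have bound: "cmod (set_lebesgue_integral lborel {-R..R} (\<lambda>t. G (of_real t))) \<le> \<bar>K\<bar> * pi / R"
    if R: "R > 0" "R \<ge> r" for R :: real
  proof -
    let ?g = "linepath (of_real (-R)) (of_real R) +++ part_circlepath 0 R 0 pi"
    have im: "Im w \<ge> 0 \<and> cmod w = R" if "w \<in> path_image (part_circlepath 0 R 0 pi)" for w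
    proof -
      from that obtain x where x: "0 \<le> x" "x \<le> pi" "w = 0 + R * exp (\<i> * of_real x)"
        unfolding path_image_part_circlepath[OF pi_ge_zero] by auto
      then show ?thesis using R
        by (auto simp: Im_exp norm_mult sin_ge_zero)
    qed
    have sub: "path_image (linepath (of_real (-R)) (of_real R)) \<subseteq> {z. Im z > -d}"
      "path_image (part_circlepath 0 R 0 pi) \<subseteq> {z. Im z > -d}"
      using d im by (force simp: path_image_linepath closed_segment_def)+
    have e: "pathfinish (linepath (of_real (-R)) (of_real R)) = pathstart (part_circlepath 0 R 0 pi)"
      "pathfinish (part_circlepath 0 R 0 pi) = of_real (-R)"
      by (simp_all add: exp_Euler)
    have "(G has_contour_integral 0) ?g"
      by (rule Cauchy_theorem_convex_simple[OF hol S])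
         (use sub e in \<open>auto simp: path_image_join\<close>)
    moreover have cont: "continuous_on {z. Im z > -d} G"
      using hol by (rule holomorphic_on_imp_continuous_on)
    have i1: "G contour_integrable_on linepath (of_real (-R)) (of_real R)"
      by (intro contour_integrable_continuous_linepath continuous_on_subset[OF cont]) (use sub in \<open>simp add: path_image_linepath\<close>)
    have i2: "G contour_integrable_on part_circlepath 0 R 0 pi"
      by (intro contour_integrable_continuous_part_circlepath continuous_on_subset[OF cont] sub)
    have "contour_integral ?g G = contour_integral (linepath (of_real (-R)) (of_real R)) G
        + contour_integral (part_circlepath 0 R 0 pi) G"
      using i1 i2 e by (intro contour_integral_join) auto
    ultimately have "contour_integral (linepath (of_real (-R)) (of_real R)) G
        + contour_integral (part_circlepath 0 R 0 pi) G = 0"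
      by (metis contour_integral_unique)
    then have "contour_integral (linepath (of_real (-R)) (of_real R)) G
        = - contour_integral (part_circlepath 0 R 0 pi) G"
      by (simp add: eq_neg_iff_add_eq_0)
    then have n: "cmod (contour_integral (linepath (of_real (-R)) (of_real R)) G)
        = cmod (contour_integral (part_circlepath 0 R 0 pi) G)" by simp
    have "cmod (contour_integral (part_circlepath 0 R 0 pi) G) \<le> \<bar>K\<bar> / R\<^sup>2 * R * \<bar>pi - 0\<bar>"
    proof (rule contour_integral_bound_part_circlepath[OF i2])
      fix w assume "w \<in> path_image (part_circlepath 0 R 0 pi)"
      then have w: "Im w \<ge> 0" "cmod w = R" using im by auto
      have "cmod (G w) \<le> K / R\<^sup>2" using decay[OF w(1)] w(2) R by auto
      also have "\<dots> \<le> \<bar>K\<bar> / R\<^sup>2" by (intro divide_right_mono) auto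
      finally show "cmod (G w) \<le> \<bar>K\<bar> / R\<^sup>2" .
    qed (use R in auto)
    also have "\<dots> = \<bar>K\<bar> * pi / R" using R by (simp add: power2_eq_square)
    finally have "cmod (contour_integral (linepath (of_real (-R)) (of_real R)) G) \<le> \<bar>K\<bar> * pi / R" using n by simp
    also have "contour_integral (linepath (of_real (-R)) (of_real R)) G = integral {-R..R} (\<lambda>x. G (of_real x))"
      using R by (subst contour_integral_linepath_Reals_eq) auto
    also have "\<dots> = set_lebesgue_integral lborel {-R..R} (\<lambda>t. G (of_real t))"
      by (intro set_borel_integral_eq_integral(2)[symmetric])
         (unfold set_integrable_def, intro integrable_mult_indicator int, simp)
    finally show ?thesis .
  qed
  have lim: "(\<lambda>n. set_lebesgue_integral lborel {-real n..real n} (\<lambda>t. G (of_real t)))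
      \<longlonglongrightarrow> (LINT t|lborel. G (of_real t))"
    unfolding set_lebesgue_integral_def
  proof (rule integral_dominated_convergence[where w="\<lambda>t. cmod (G (of_real t))"])
    show "AE x in lborel. (\<lambda>i. indicat_real {- real i..real i} x *\<^sub>R G (complex_of_real x))
         \<longlonglongrightarrow> G (complex_of_real x)"
    proof (intro AE_I2 tendsto_eventually)
      fix x :: real
      have "eventually (\<lambda>n. real n \<ge> \<bar>x\<bar>) sequentially"
        using eventually_ge_at_top[of "nat \<lceil>\<bar>x\<bar>\<rceil>"] by eventually_elim linarith
      then show "\<forall>\<^sub>F i in sequentially. indicat_real {- real i..real i} x *\<^sub>R G (complex_of_real x) = G (complex_of_real x)"
        by eventually_elim (auto simp: indicator_def)
    qed
  qed (use int in \<open>auto intro: borel_measurable_integrable simp: indicator_def\<close>)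
  moreover have "(\<lambda>n. set_lebesgue_integral lborel {-real n..real n} (\<lambda>t. G (of_real t))) \<longlonglongrightarrow> 0"
  proof (rule Lim_null_comparison)
    have "eventually (\<lambda>n. real n \<ge> max r 1) sequentially"
      using eventually_ge_at_top[of "nat \<lceil>max r 1\<rceil>"] by eventually_elim linarith
    then show "\<forall>\<^sub>F n in sequentially. cmod (set_lebesgue_integral lborel {-real n..real n} (\<lambda>t. G (of_real t))) \<le> \<bar>K\<bar> * pi / real n"
      by eventually_elim (rule bound, auto)
    show "(\<lambda>n. \<bar>K\<bar> * pi / real n) \<longlonglongrightarrow> 0" by (rule lim_const_over_n)
  qed
  ultimately show ?thesis using LIMSEQ_unique by blast
qed

text \<open>
  Apply the previous lemma to \<open>(g w - g z) / ((w - z) * (w - cnj z))\<close>. The singularity at \<open>z\<close> is removable,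
  the one at \<open>cnj z\<close> lies in the lower half-plane, and on the real line the denominator is
  \<open>(cmod (w - z))\<^sup>2\<close>; so the integral of \<open>poisson z t * (g t - g z)\<close> vanishes.
\<close>

lemma poisson_formula_bounded:
  fixes g :: "complex \<Rightarrow> complex"
  assumes hol: "g holomorphic_on {z. Im z > -d}" and d: "d > 0"
    and B: "\<And>w. Im w \<ge> 0 \<Longrightarrow> cmod (g w) \<le> B" and z: "Im z > 0"
  shows "integrable lborel (\<lambda>t. poisson z t * g (of_real t))"
    and "(LINT t|lborel. poisson z t * g (of_real t)) = g z"
proof -
  have B0: "B \<ge> 0" using B[of z] z norm_ge_zero[of "g z"] by linarith
  have cont: "continuous_on {z. Im z > -d} g"
    using hol by (rule holomorphic_on_imp_continuous_on)
  have [measurable]: "(\<lambda>t. g (complex_of_real t)) \<in> borel_measurable borel"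
    by (intro borel_measurable_continuous_onI continuous_on_compose2[OF cont] continuous_intros) (use d in auto)
  have bint: "integrable lborel (\<lambda>t. poisson z t * h t)"
    if "h \<in> borel_measurable borel" "\<And>t. cmod (h t) \<le> C" for h :: "real \<Rightarrow> complex" and C
  proof (rule Bochner_Integration.integrable_bound[where f="\<lambda>t. C * poisson z t"])
    show "AE t in lborel. norm (complex_of_real (poisson z t) * h t) \<le> norm (C * poisson z t)"
      using poisson_nonneg[OF z] order_trans[OF that(2) abs_ge_self]
      by (intro AE_I2) (simp add: norm_mult abs_mult mult.commute[of "\<bar>C\<bar>"] mult_left_mono)
  qed (use that z integrable_poisson in auto)
  show int: "integrable lborel (\<lambda>t. poisson z t * g (of_real t))"
    by (rule bint[where C=B]) (auto intro: B)
  \<comment> \<open>The value at \<open>z\<close> fills the removable singularity.\<close>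
  define q where "q w = (if w = z then deriv g z else (g w - g z) / (w - z))" for w
  define d' where "d' = min d (Im z)"
  define G where "G w = q w / (w - cnj z)" for w
  have "open {z. Im z > -d'}" by (rule open_halfspace_Im_gt)
  have "q holomorphic_on {z. Im z > -d'}"
    unfolding q_def by (rule pole_lemma_open) (use open_halfspace_Im_gt hol in \<open>auto simp: d'_def intro: holomorphic_on_subset\<close>)
  then have holG: "G holomorphic_on {z. Im z > -d'}"
    unfolding G_def by (intro holomorphic_intros) (auto simp: d'_def)
  have Gt: "G (of_real t) = pi / Im z * (poisson z t * (g (of_real t) - g z))" for t
  proof -
    have "(of_real t - z) * (of_real t - cnj z) = complex_of_real ((cmod (of_real t - z))\<^sup>2)"
      by (metis complex_cnj_complex_of_real complex_cnj_diff complex_norm_square)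
    then show ?thesis
      using z real_neq_upper[OF z, of t]
      by (auto simp: G_def q_def poisson_def field_simps)
  qed
  have "(LINT t|lborel. G (of_real t)) = 0"
  proof (rule integral_real_line_zero[OF holG])
    show "d' > 0" using d z by (simp add: d'_def)
    fix w assume w: "Im w \<ge> 0" "cmod w \<ge> 2 * cmod z"
    have z0: "cmod z > 0" using z by (auto simp: complex_eq_iff)
    then have w0: "cmod w > 0" using w by linarith
    have 1: "cmod (w - z) \<ge> cmod w / 2" "cmod (w - cnj z) \<ge> cmod w / 2"
      using w norm_triangle_ineq2[of w z] norm_triangle_ineq2[of w "cnj z"] by auto
    have "w \<noteq> z" using w z0 by auto
    then have "cmod (G w) = cmod (g w - g z) / (cmod (w - z) * cmod (w - cnj z))"
      by (simp add: G_def q_def norm_mult norm_divide)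
    also have "\<dots> \<le> (2 * B) / (cmod w / 2 * (cmod w / 2))"
      using 1 w0 B0 B[OF w(1)] B[of z] z norm_triangle_ineq4[of "g w" "g z"]
      by (intro frac_le mult_mono) auto
    finally show "cmod (G w) \<le> (8 * B) / (cmod w)\<^sup>2"
      by (simp add: power2_eq_square)
  next
    show "integrable lborel (\<lambda>t. G (complex_of_real t))"
      unfolding Gt
    proof (intro integrable_mult_right bint[where C="2*B"])
      fix t :: real
      show "cmod (g (of_real t) - g z) \<le> 2 * B"
        using B[of "of_real t"] B[of z] z norm_triangle_ineq4[of "g (of_real t)" "g z"] by simp
    qed simp
  qed
  then have "(LINT t|lborel. pi / Im z * (poisson z t * (g (of_real t) - g z))) = 0"
    unfolding Gt .
  then have "(LINT t|lborel. poisson z t * (g (of_real t) - g z)) = 0"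
    using z by simp
  moreover have "(LINT t|lborel. poisson z t * (g (of_real t) - g z))
      = (LINT t|lborel. poisson z t * g (of_real t)) - (LINT t|lborel. poisson z t *g z)"
    unfolding right_diff_distrib
    by (intro Bochner_Integration.integral_diff int bint[where C="cmod (g z)"]) auto
  ultimately show "(LINT t|lborel. poisson z t * g (of_real t)) = g z"
    using integral_poisson[OF z] by simp
qed

section \<open>Square integrable functions and Poisson averages\<close>

lemma poisson_Complex: "poisson (Complex x s) t = s / (pi * ((t - x)\<^sup>2 + s\<^sup>2))"
  by (simp add: poisson_def cmod_real_diff_sq)

text \<open>
  Borel (not Lebesgue) measurable representatives, so that products of functions of different variables are
  measurable for the product \<sigma>-algebra and Tonelli's theorem applies.
\<close>

definition L2 :: "(real \<Rightarrow> complex) set" where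
  "L2 = {u \<in> borel_measurable borel. integrable lborel (\<lambda>x. (cmod (u x))\<^sup>2)}"

definition sqnorm :: "(real \<Rightarrow> complex) \<Rightarrow> real" where
  "sqnorm u = (LINT x|lborel. (cmod (u x))\<^sup>2)"

definition slice :: "(complex \<Rightarrow> complex) \<Rightarrow> real \<Rightarrow> real \<Rightarrow> complex" where
  "slice f y = (\<lambda>x. f (Complex x y))"

lemma L2_measurable [measurable_dest]: "u \<in> L2 \<Longrightarrow> u \<in> borel_measurable borel"
  and L2_integrable: "u \<in> L2 \<Longrightarrow> integrable lborel (\<lambda>x. (cmod (u x))\<^sup>2)"
  by (simp_all add: L2_def)

lemma sqnorm_nonneg: "0 \<le> sqnorm u"
  by (simp add: sqnorm_def)

lemma nn_integral_eq_sqnorm: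
  "u \<in> L2 \<Longrightarrow> (\<integral>\<^sup>+x. ennreal ((cmod (u x))\<^sup>2) \<partial>lborel) = ennreal (sqnorm u)"
  by (simp add: sqnorm_def nn_integral_eq_integral L2_integrable)

lemma L2I:
  assumes "u \<in> borel_measurable borel" "(\<integral>\<^sup>+x. ennreal ((cmod (u x))\<^sup>2) \<partial>lborel) \<le> ennreal M" "M \<ge> 0"
  shows "u \<in> L2" "sqnorm u \<le> M"
proof -
  have "integrable lborel (\<lambda>x. (cmod (u x))\<^sup>2)"
    using assms by (intro integrableI_bounded) (auto simp: ennreal_power le_less_trans)
  then show L: "u \<in> L2" using assms(1) by (simp add: L2_def)
  show "sqnorm u \<le> M" using assms(2,3) nn_integral_eq_sqnorm[OF L] by simp
qed

lemma two_mult_cmod_le: "2 * cmod (a * b) \<le> (cmod a)\<^sup>2 + (cmod b)\<^sup>2"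
  using sum_squares_bound[of "cmod a" "cmod b"] by (simp add: norm_mult mult.assoc)

lemma L2_mult_integrable:
  assumes "u \<in> L2" "v \<in> L2"
  shows "integrable lborel (\<lambda>x. u x * v x)"
proof (rule Bochner_Integration.integrable_bound)
  show "integrable lborel (\<lambda>x. (cmod (u x))\<^sup>2 + (cmod (v x))\<^sup>2)"
    using assms by (intro Bochner_Integration.integrable_add L2_integrable)
  show "AE x in lborel. norm (u x * v x) \<le> norm ((cmod (u x))\<^sup>2 + (cmod (v x))\<^sup>2)"
  proof (intro AE_I2)
    fix x
    show "norm (u x * v x) \<le> norm ((cmod (u x))\<^sup>2 + (cmod (v x))\<^sup>2)"
      using two_mult_cmod_le[of "u x" "v x"] norm_ge_zero[of "u x * v x"] by (simp del: norm_ge_zero)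
  qed
qed (use assms in measurable)

lemma L2_cnj: "u \<in> L2 \<Longrightarrow> (\<lambda>x. cnj (u x)) \<in> L2"
  by (auto simp: L2_def intro: borel_measurable_continuous_on[OF continuous_on_cnj[OF continuous_on_id]])

lemma cmod_diff_sq: "complex_of_real ((cmod (a - b))\<^sup>2) = a * cnj a + b * cnj b - a * cnj b - b * cnj a"
  by (simp only: complex_norm_square) (simp add: algebra_simps)

lemma L2_diff:
  assumes "u \<in> L2" "v \<in> L2"
  shows "(\<lambda>x. u x - v x) \<in> L2"
proof -
  have "integrable lborel (\<lambda>x. complex_of_real ((cmod (u x - v x))\<^sup>2))"
    unfolding cmod_diff_sq using assms
    by (intro Bochner_Integration.integrable_add Bochner_Integration.integrable_diff L2_mult_integrable L2_cnj)
  then have "integrable lborel (\<lambda>x. Re (complex_of_real ((cmod (u x - v x))\<^sup>2)))"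
    by (rule integrable_Re)
  then show ?thesis
    using assms by (auto simp: L2_def)
qed

lemma sqnorm_diff:
  assumes "u \<in> L2" "v \<in> L2"
  shows "sqnorm (\<lambda>x. u x - v x) = sqnorm u + sqnorm v - 2 * Re (LINT x|lborel. u x * cnj (v x))"
proof -
  have I: "integrable lborel (\<lambda>x. u x * cnj (v x))" "integrable lborel (\<lambda>x. (cmod (u x))\<^sup>2)" "integrable lborel (\<lambda>x. (cmod (v x))\<^sup>2)"
    using assms by (auto intro!: L2_mult_integrable L2_cnj L2_integrable)
  have "(cmod (a - b))\<^sup>2 = (cmod a)\<^sup>2 + (cmod b)\<^sup>2 - 2 * Re (a * cnj b)" for a b
    unfolding cmod_power2 by (simp add: power2_eq_square algebra_simps)
  then have "sqnorm (\<lambda>x. u x - v x) = (LINT x|lborel. ((cmod (u x))\<^sup>2 + (cmod (v x))\<^sup>2) - 2 * Re (u x * cnj (v x)))"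
    by (simp add: sqnorm_def)
  also have "\<dots> = sqnorm u + sqnorm v - 2 * (LINT x|lborel. Re (u x * cnj (v x)))"
  proof -
    have "(LINT x|lborel. (a x + b x) - 2 * c x) = (LINT x|lborel. a x) + (LINT x|lborel. b x) - 2 * (LINT x|lborel. c x)"
      if "integrable lborel a" "integrable lborel b" "integrable lborel c" for a b c :: "real \<Rightarrow> real"
      using that by simp
    from this[OF I(2,3) integrable_Re[OF I(1)]] show ?thesis
      unfolding sqnorm_def .
  qed
  also have "(LINT x|lborel. Re (u x * cnj (v x))) = Re (LINT x|lborel. u x * cnj (v x))"
    by (rule integral_Re[OF I(1)])
  finally show ?thesis .
qed

lemma poisson_L2_integrable:
  fixes u :: "real \<Rightarrow> complex"
  assumes u: "u \<in> L2" and z: "Im z > 0"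
  shows "integrable lborel (\<lambda>t. poisson z t * (cmod (u t))\<^sup>2)"
    and "(LINT t|lborel. poisson z t * (cmod (u t))\<^sup>2) \<le> sqnorm u / (pi * Im z)"
    and "integrable lborel (\<lambda>t. poisson z t * u t)"
proof -
  note [measurable] = L2_measurable[OF u] borel_measurable_poisson[OF z]
  have le: "poisson z t * (cmod (u t))\<^sup>2 \<le> (1 / (pi * Im z)) * (cmod (u t))\<^sup>2" for t
    using poisson_le[OF z] by (intro mult_right_mono) auto
  show 1: "integrable lborel (\<lambda>t. poisson z t * (cmod (u t))\<^sup>2)"
    by (rule Bochner_Integration.integrable_bound[where f="\<lambda>t. (1 / (pi * Im z)) * (cmod (u t))\<^sup>2"])
       (use le z in \<open>auto intro!: integrable_mult_right L2_integrable[OF u] AE_I2 simp: poisson_nonneg abs_mult\<close>)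
  have "(LINT t|lborel. poisson z t * (cmod (u t))\<^sup>2) \<le> (LINT t|lborel. (1 / (pi * Im z)) * (cmod (u t))\<^sup>2)"
    by (intro integral_mono 1 integrable_mult_right L2_integrable[OF u] le)
  then show "(LINT t|lborel. poisson z t * (cmod (u t))\<^sup>2) \<le> sqnorm u / (pi * Im z)"
    by (simp add: sqnorm_def)
  show "integrable lborel (\<lambda>t. poisson z t * u t)"
  proof (rule Bochner_Integration.integrable_bound)
    show "integrable lborel (\<lambda>t. poisson z t + poisson z t * (cmod (u t))\<^sup>2)"
      using 1 integrable_poisson[OF z] by auto
    have "c \<le> 1 + c\<^sup>2" for c :: real
      using sum_squares_bound[of c 1] by (cases "c \<ge> 0") (auto intro: order_trans[of c 0])
    then have "poisson z t * cmod (u t) \<le> poisson z t * (1 + (cmod (u t))\<^sup>2)" for t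
      using poisson_nonneg[OF z] by (intro mult_left_mono)
    then show "AE t in lborel. norm (poisson z t * u t) \<le> norm (poisson z t + poisson z t * (cmod (u t))\<^sup>2)"
      using poisson_nonneg[OF z] by (intro AE_I2) (auto simp: norm_mult algebra_simps intro: order_trans[OF _ abs_ge_self])
  qed measurable
qed

text \<open>
  Jensen's inequality for the probability density \<open>poisson z\<close>: the variance of \<open>u\<close> is nonnegative.
\<close>

lemma poisson_L2_jensen:
  fixes u :: "real \<Rightarrow> complex"
  assumes u: "u \<in> L2" and z: "Im z > 0"
  shows "(cmod (LINT t|lborel. poisson z t * u t))\<^sup>2 \<le> (LINT t|lborel. poisson z t * (cmod (u t))\<^sup>2)"
proof -
  note I = poisson_L2_integrable[OF u z] integrable_poisson[OF z]
  define c where "c = (LINT t|lborel. poisson z t * u t)"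
  have e: "poisson z t * (cmod (u t - c))\<^sup>2 =
      poisson z t * (cmod (u t))\<^sup>2 + (poisson z t * (cmod c)\<^sup>2 - 2 * Re ((poisson z t * u t) * cnj c))" for t
    unfolding cmod_power2 by (simp add: power2_eq_square algebra_simps)
  have "0 \<le> (LINT t|lborel. poisson z t * (cmod (u t - c))\<^sup>2)"
    using poisson_nonneg[OF z] by (intro integral_nonneg_AE) auto
  also have "\<dots> = (LINT t|lborel. poisson z t * (cmod (u t))\<^sup>2) +
      ((cmod c)\<^sup>2 - 2 * Re ((LINT t|lborel. poisson z t * u t) * cnj c))"
    unfolding e
  proof (subst Bochner_Integration.integral_add)
    have J: "integrable lborel (\<lambda>t. poisson z t * u t * cnj c)" using I by auto
    show "integrable lborel (\<lambda>t. poisson z t * (cmod c)\<^sup>2 - 2 * Re ((poisson z t * u t) * cnj c))"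
      using I J by (intro Bochner_Integration.integrable_diff integrable_mult_right integrable_Re) auto
    have "(LINT t|lborel. poisson z t * (cmod c)\<^sup>2 - 2 * Re ((poisson z t * u t) * cnj c))
      = (LINT t|lborel. poisson z t * (cmod c)\<^sup>2) - (LINT t|lborel. 2 * Re ((poisson z t * u t) * cnj c))"
      using I J by (intro Bochner_Integration.integral_diff integrable_mult_right integrable_Re) auto
    also have "(LINT t|lborel. 2 * Re ((poisson z t * u t) * cnj c)) = 2 * (LINT t|lborel. Re ((poisson z t * u t) * cnj c))"
      by (rule integral_mult_right_zero)
    also have "(LINT t|lborel. Re ((poisson z t * u t) * cnj c)) = Re (LINT t|lborel. (poisson z t * u t) * cnj c)"
      using J by (rule integral_Re)
    also have "(LINT t|lborel. (poisson z t * u t) * cnj c) = (LINT t|lborel. poisson z t * u t) * cnj c"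
      by (rule integral_mult_left_zero)
    finally show "(LINT t|lborel. poisson z t * (cmod (u t))\<^sup>2) +
    (LINT t|lborel. poisson z t * (cmod c)\<^sup>2 - 2 * Re (complex_of_real (poisson z t) * u t * cnj c)) =
    (LINT t|lborel. poisson z t * (cmod (u t))\<^sup>2) +
    ((cmod c)\<^sup>2 - 2 * Re ((LINT t|lborel. complex_of_real (poisson z t) * u t) * cnj c))"
      by (simp add: integral_poisson[OF z])
  qed (use I in auto)
  also have "(LINT t|lborel. poisson z t * u t) * cnj c = of_real ((cmod c)\<^sup>2)"
    by (metis c_def complex_norm_square)
  finally show ?thesis by (simp add: c_def)
qed

text \<open>
  Averaging against the kernel preserves mass on every horizontal line, because the kernel is symmetric in
  the two real variables.
\<close>

lemma nn_integral_poisson_extension: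
  assumes s: "s > 0" and [measurable]: "w \<in> borel_measurable borel"
  shows "(\<integral>\<^sup>+x. (\<integral>\<^sup>+t. ennreal (poisson (Complex x s) t) * w t \<partial>lborel) \<partial>lborel) = (\<integral>\<^sup>+t. w t \<partial>lborel)"
proof -
  have "(\<integral>\<^sup>+x. (\<integral>\<^sup>+t. ennreal (poisson (Complex x s) t) * w t \<partial>lborel) \<partial>lborel) =
      (\<integral>\<^sup>+t. (\<integral>\<^sup>+x. ennreal (poisson (Complex x s) t) * w t \<partial>lborel) \<partial>lborel)"
    unfolding poisson_Complex by (rule lborel_pair.Fubini') measurable
  also have "\<dots> = (\<integral>\<^sup>+t. w t * (\<integral>\<^sup>+x. ennreal (poisson (Complex t s) x) \<partial>lborel) \<partial>lborel)"
    by (subst nn_integral_cmult[symmetric]) (auto simp: poisson_swap[of _ s] mult.commute s)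
  also have "\<dots> = (\<integral>\<^sup>+t. w t \<partial>lborel)"
    using s by (simp add: nn_integral_poisson)
  finally show ?thesis .
qed

text \<open>
  Fubini's theorem and the symmetry of the kernel in \<open>x\<close> and \<open>t\<close>. The double integral converges absolutely,
  as the product of the two functions is dominated by the sum of their squares.
\<close>

lemma poisson_selfadjoint:
  fixes u v :: "real \<Rightarrow> complex"
  assumes u: "u \<in> L2" and v: "v \<in> L2" and s: "s > 0"
  shows "(LINT x|lborel. (LINT t|lborel. poisson (Complex x s) t * u t) * cnj (v x)) =
         (LINT x|lborel. u x * cnj (LINT t|lborel. poisson (Complex x s) t * v t))"
proof -
  note [measurable] = L2_measurable[OF u] L2_measurable[OF v] L2_measurable[OF L2_cnj[OF v]]
  let ?F = "\<lambda>(x, t). poisson (Complex x s) t * u t * cnj (v x)"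
  have int: "integrable (lborel \<Otimes>\<^sub>M lborel) ?F"
  proof (rule integrableI_bounded)
    show "?F \<in> borel_measurable (lborel \<Otimes>\<^sub>M lborel)"
      unfolding poisson_Complex by measurable
    have "(\<integral>\<^sup>+p. ennreal (norm (?F p)) \<partial>(lborel \<Otimes>\<^sub>M lborel))
        = (\<integral>\<^sup>+x. (\<integral>\<^sup>+t. ennreal (norm (?F (x, t))) \<partial>lborel) \<partial>lborel)"
      unfolding poisson_Complex by (subst lborel.nn_integral_fst[symmetric]) measurable
    also have "\<dots> \<le> (\<integral>\<^sup>+x. (\<integral>\<^sup>+t. ennreal (poisson (Complex x s) t) * ennreal ((cmod (u t))\<^sup>2)
           + ennreal (poisson (Complex x s) t) * ennreal ((cmod (v x))\<^sup>2) \<partial>lborel) \<partial>lborel)"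
    proof (intro nn_integral_mono)
      fix x t
      have "cmod (u t * cnj (v x)) \<le> (cmod (u t))\<^sup>2 + (cmod (v x))\<^sup>2"
        using two_mult_cmod_le[of "u t" "cnj (v x)"] norm_ge_zero[of "u t * cnj (v x)"] unfolding complex_mod_cnj by linarith
      then have "poisson (Complex x s) t * cmod (u t * cnj (v x)) \<le> poisson (Complex x s) t * ((cmod (u t))\<^sup>2 + (cmod (v x))\<^sup>2)"
        using s by (intro mult_left_mono poisson_nonneg) auto
      then show "ennreal (norm (?F (x, t))) \<le> ennreal (poisson (Complex x s) t) * ennreal ((cmod (u t))\<^sup>2)
           + ennreal (poisson (Complex x s) t) * ennreal ((cmod (v x))\<^sup>2)"
        using s by (simp add: ennreal_mult'[symmetric] ennreal_plus[symmetric] poisson_nonneg norm_mult algebra_simps del: ennreal_plus)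
    qed
    also have "\<dots> = (\<integral>\<^sup>+x. (\<integral>\<^sup>+t. ennreal (poisson (Complex x s) t) * ennreal ((cmod (u t))\<^sup>2) \<partial>lborel)
        + ennreal ((cmod (v x))\<^sup>2) \<partial>lborel)"
      using s by (subst nn_integral_add) (auto simp: nn_integral_multc nn_integral_poisson)
    also have "\<dots> = (\<integral>\<^sup>+x. (\<integral>\<^sup>+t. ennreal (poisson (Complex x s) t) * ennreal ((cmod (u t))\<^sup>2) \<partial>lborel) \<partial>lborel)
        + (\<integral>\<^sup>+x. ennreal ((cmod (v x))\<^sup>2) \<partial>lborel)"
      unfolding poisson_Complex by (intro nn_integral_add) measurable
    also have "\<dots> = ennreal (sqnorm u) + ennreal (sqnorm v)"
      using s by (simp add: nn_integral_poisson_extension nn_integral_eq_sqnorm u v)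
    also have "\<dots> < \<infinity>" by simp
    finally show "(\<integral>\<^sup>+p. ennreal (norm (?F p)) \<partial>(lborel \<Otimes>\<^sub>M lborel)) < \<infinity>" .
  qed
  have "(LINT x|lborel. (LINT t|lborel. poisson (Complex x s) t * u t) * cnj (v x)) =
      (LINT x|lborel. (LINT t|lborel. ?F (x, t)))"
    by simp
  also have "\<dots> = (LINT t|lborel. (LINT x|lborel. ?F (x, t)))"
    using lborel_pair.Fubini_integral[of "\<lambda>x t. ?F (x, t)"] int by simp
  also have "\<dots> = (LINT t|lborel. u t * cnj (LINT x|lborel. poisson (Complex t s) x * v x))"
  proof (intro Bochner_Integration.integral_cong refl)
    fix t
    have "(LINT x|lborel. ?F (x, t)) = (LINT x|lborel. u t * cnj (poisson (Complex t s) x * v x))"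
      by (intro Bochner_Integration.integral_cong refl) (simp add: poisson_swap[of _ s t] mult.commute mult.left_commute)
    also have "\<dots> = u t * (LINT x|lborel. cnj (poisson (Complex t s) x * v x))"
      by (rule integral_mult_right_zero)
    also have "(LINT x|lborel. cnj (poisson (Complex t s) x * v x)) = cnj (LINT x|lborel. poisson (Complex t s) x * v x)"
      by (rule Bochner_Integration.integral_cnj)
    finally show "(LINT x|lborel. ?F (x, t)) = u t * cnj (LINT x|lborel. poisson (Complex t s) x * v x)" .
  qed
  finally show ?thesis .
qed

section \<open>Horizontal slices of Hardy functions\<close>

lemma slice_continuous:
  assumes "f holomorphic_on upper_half_plane" "y > 0"
  shows "continuous_on UNIV (slice f y)"
  unfolding slice_def
  by (rule continuous_on_compose2[OF holomorphic_on_imp_continuous_on[OF assms(1)]])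
     (use assms(2) in \<open>auto simp: upper_half_plane_def Complex_eq intro!: continuous_intros\<close>)

lemma slice_measurable:
  "f holomorphic_on upper_half_plane \<Longrightarrow> y > 0 \<Longrightarrow> slice f y \<in> borel_measurable borel"
  by (intro borel_measurable_continuous_onI slice_continuous)

lemma hardy2_iff:
  "f \<in> hardy2 \<longleftrightarrow> f holomorphic_on upper_half_plane \<and>
     (\<exists>M\<ge>0. \<forall>y>0. (\<integral>\<^sup>+x. ennreal ((cmod (slice f y x))\<^sup>2) \<partial>lborel) \<le> ennreal M)" (is "?A \<longleftrightarrow> ?B")
proof
  assume f: ?A
  define S where "S = (SUP y\<in>{0<..}. \<integral>\<^sup>+x. ennreal ((cmod (f (Complex x y)))\<^sup>2) \<partial>lebesgue)"
  have "S < \<infinity>" using f by (simp add: hardy2_def S_def)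
  then have "S = ennreal (enn2real S)" by (simp add: less_top)
  moreover have "(\<integral>\<^sup>+x. ennreal ((cmod (slice f y x))\<^sup>2) \<partial>lborel) \<le> S" if "y > 0" for y
    unfolding S_def using that by (intro SUP_upper2[of y]) (auto simp: nn_integral_completion slice_def)
  ultimately show ?B using f by (auto simp: hardy2_def intro!: exI[of _ "enn2real S"])
next
  assume ?B
  then obtain M where M: "\<forall>y>0. (\<integral>\<^sup>+x. ennreal ((cmod (slice f y x))\<^sup>2) \<partial>lborel) \<le> ennreal M" and h: "f holomorphic_on upper_half_plane" by blast
  have "(SUP y\<in>{0<..}. \<integral>\<^sup>+x. ennreal ((cmod (f (Complex x y)))\<^sup>2) \<partial>lebesgue) \<le> ennreal M"
    using M by (intro SUP_least) (auto simp: nn_integral_completion slice_def)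
  then show ?A using h by (auto simp: hardy2_def le_less_trans)
qed

lemma hardy2_holomorphic: "f \<in> hardy2 \<Longrightarrow> f holomorphic_on upper_half_plane"
  by (simp add: hardy2_def)

lemma hardy2_slices:
  assumes "f \<in> hardy2"
  obtains M where "M \<ge> 0" "\<And>y. y > 0 \<Longrightarrow> slice f y \<in> L2" "\<And>y. y > 0 \<Longrightarrow> sqnorm (slice f y) \<le> M"
proof -
  obtain M where M: "M \<ge> 0" "\<And>y. y>0 \<Longrightarrow> (\<integral>\<^sup>+x. ennreal ((cmod (slice f y x))\<^sup>2) \<partial>lborel) \<le> ennreal M"
    using assms by (auto simp: hardy2_iff)
  show ?thesis
    by (rule that[OF M(1)]) (use L2I[OF slice_measurable M(2) M(1)] hardy2_holomorphic[OF assms] in auto)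
qed

lemma open_upper_half_plane: "open upper_half_plane"
  and convex_upper_half_plane: "convex upper_half_plane"
  unfolding upper_half_plane_def by (rule open_halfspace_Im_gt, rule convex_halfspace_Im_gt)

lemma hardy2_slice_L2: "f \<in> hardy2 \<Longrightarrow> y > 0 \<Longrightarrow> slice f y \<in> L2"
  using hardy2_slices by blast

lemma le_one_plus_square: "c \<le> 1 + c\<^sup>2" for c :: real
  using sum_squares_bound[of c 1] by (cases "c \<ge> 0") (auto intro: order_trans[of c 0])

text \<open>
  If \<open>A\<close> is a primitive of \<open>f\<close>, then \<open>A (z + t) - A z\<close> is an integral of \<open>f\<close> along a horizontal segment
  and hence bounded by the norm alone. Cauchy's estimate bounds its derivative \<open>f (z + t) - f z\<close>, and for
  some \<open>t\<close> in the unit interval \<open>f (z + t)\<close> itself is bounded by the norm, as its mean square is.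
\<close>

lemma hardy2_bounded:
  assumes f: "f \<in> hardy2" and e: "e > 0"
  obtains B where "\<And>z. Im z \<ge> e \<Longrightarrow> cmod (f z) \<le> B"
proof -
  obtain M where M: "M \<ge> 0" "\<And>y. y > 0 \<Longrightarrow> slice f y \<in> L2" "\<And>y. y > 0 \<Longrightarrow> sqnorm (slice f y) \<le> M"
    using hardy2_slices[OF f] by blast
  obtain A where "\<And>z. z \<in> upper_half_plane \<Longrightarrow> (A has_field_derivative f z) (at z within upper_half_plane)"
    using holomorphic_convex_primitive'[OF convex_upper_half_plane open_upper_half_plane hardy2_holomorphic[OF f]] by blast
  then have A: "(A has_field_derivative f z) (at z)" if "Im z > 0" for z
    using that at_within_open[OF _ open_upper_half_plane] by (auto simp: upper_half_plane_def)
  have step1: "cmod (A (z + of_real t) - A z) \<le> M + 1" if z: "Im z > 0" and t: "0 \<le> t" "t \<le> 1" for z t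
  proof -
    note u = M(2,3)[OF z]
    note [measurable] = L2_measurable[OF u(1)]
    let ?I = "\<lambda>x. indicat_real {Re z..Re z + t} x *\<^sub>R slice f (Im z) x"
    have "(LINT x|lborel. ?I x) = A (Complex (Re z + t) (Im z)) - A (Complex (Re z) (Im z))"
    proof (rule integral_FTC_Icc)
      show "((\<lambda>x. A (Complex x (Im z))) has_vector_derivative slice f (Im z) x) (at x within {Re z..Re z + t})" for x
      proof -
        have "((\<lambda>x. Complex x (Im z)) has_vector_derivative 1) (at x within {Re z..Re z + t})"
          unfolding Complex_eq by (auto intro!: derivative_eq_intros)
        from field_vector_diff_chain_within[OF this has_field_derivative_at_within[OF A]] z
        show ?thesis by (simp add: o_def slice_def)
      qed
      show "continuous_on {Re z..Re z + t} (slice f (Im z))"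
        using slice_continuous[OF hardy2_holomorphic[OF f] z] by (rule continuous_on_subset) simp
    qed (use t in simp)
    also have "Complex (Re z + t) (Im z) = z + of_real t" by (simp add: complex_eq_iff)
    finally have "cmod (A (z + of_real t) - A z) = cmod (LINT x|lborel. ?I x)" by simp
    also have "\<dots> \<le> (LINT x|lborel. cmod (?I x))"
      by (rule integral_norm_bound)
    also have "\<dots> \<le> (LINT x|lborel. indicat_real {Re z..Re z + t} x + (cmod (slice f (Im z) x))\<^sup>2)"
    proof (rule integral_mono')
      show "integrable lborel (\<lambda>x. indicat_real {Re z..Re z + t} x + (cmod (slice f (Im z) x))\<^sup>2)"
        by (intro Bochner_Integration.integrable_add L2_integrable[OF u(1)] integrable_real_indicator)
           (auto simp: emeasure_lborel_Icc_eq)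
      show "cmod (?I x) \<le> indicat_real {Re z..Re z + t} x + (cmod (slice f (Im z) x))\<^sup>2" for x
        using le_one_plus_square[of "cmod (slice f (Im z) x)"] by (auto simp: indicator_def)
    qed auto
    also have "\<dots> = t + sqnorm (slice f (Im z))"
      using L2_integrable[OF u(1)] t unfolding sqnorm_def
      by (subst Bochner_Integration.integral_add) (auto intro!: integrable_real_indicator simp: emeasure_lborel_Icc_eq)
    also have "\<dots> \<le> M + 1" using t u(2) by simp
    finally show ?thesis .
  qed
  have step2: "cmod (f (z + of_real t) - f z) \<le> (M + 1) / (e / 2)" if z: "Im z \<ge> e" and t: "0 \<le> t" "t \<le> 1" for z t
  proof -
    have im: "Im w > 0" if "dist z w \<le> e / 2" for w
      using that z e abs_Im_le_cmod[of "z - w"] by (simp add: dist_norm)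
    let ?F = "\<lambda>w. A (w + of_real t) - A w"
    have D: "(?F has_field_derivative (f (w + of_real t) - f w)) (at w)" if "Im w > 0" for w
      using that A[of w] A[of "w + of_real t"] by (intro DERIV_diff) (simp_all add: DERIV_shift)
    have "cmod ((deriv ^^ 1) ?F z) \<le> fact 1 * (M + 1) / (e / 2) ^ 1"
    proof (rule Cauchy_inequality)
      have "?F holomorphic_on {w. Im w > 0}"
        using D by (intro holomorphic_onI) (auto simp: field_differentiable_def intro: has_field_derivative_at_within)
      then show "?F holomorphic_on ball z (e / 2)"  "continuous_on (cball z (e / 2)) ?F"
        using im by (auto intro!: holomorphic_on_imp_continuous_on elim!: holomorphic_on_subset)
      show "cmod (?F w) \<le> M + 1" if "cmod (z - w) = e / 2" for w
        using step1[of w t] im[of w] that t by (simp add: dist_norm)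
    qed (use e in auto)
    then show ?thesis
      using DERIV_imp_deriv[OF D[of z]] z e by simp
  qed
  have step3: "\<exists>t\<in>{0..1}. (cmod (f (z + of_real t)))\<^sup>2 \<le> M + 1" if z: "Im z \<ge> e" for z
  proof (rule ccontr)
    assume "\<not> ?thesis"
    then have n: "(cmod (f (z + of_real t)))\<^sup>2 > M + 1" if "t \<in> {0..1}" for t
      using that by force
    have z0: "Im z > 0" using z e by simp
    have "(M + 1) * indicat_real {Re z..Re z + 1} x \<le> (cmod (slice f (Im z) x))\<^sup>2" for x
    proof (cases "x \<in> {Re z..Re z + 1}")
      case True
      have "Complex x (Im z) = z + of_real (x - Re z)" by (simp add: complex_eq_iff)
      then show ?thesis using n[of "x - Re z"] True by (simp add: slice_def del: of_real_diff)
    qed auto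
    then have "(LINT x|lborel. (M + 1) * indicat_real {Re z..Re z + 1} x) \<le> sqnorm (slice f (Im z))"
      unfolding sqnorm_def using L2_integrable[OF M(2)[OF z0]] by (intro integral_mono) auto
    moreover have "(LINT x|lborel. (M + 1) * indicat_real {Re z..Re z + 1} x) = M + 1"
      by simp
    ultimately show False using M(3)[OF z0] by simp
  qed
  show ?thesis
  proof (rule that)
    fix z assume z: "Im z \<ge> e"
    obtain t where t: "t \<in> {0..1}" "(cmod (f (z + of_real t)))\<^sup>2 \<le> M + 1" using step3[OF z] by blast
    have "cmod (f (z + of_real t)) \<le> M + 2"
      using le_one_plus_square[of "cmod (f (z + of_real t))"] t(2) by simp
    moreover have "cmod (f z) \<le> cmod (f (z + of_real t)) + cmod (f (z + of_real t) - f z)"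
      by (metis norm_minus_commute norm_triangle_sub)
    ultimately show "cmod (f z) \<le> (M + 2) + (M + 1) / (e / 2)"
      using step2[OF z, of t] t(1) by simp
  qed
qed

lemma poisson_formula_slice:
  assumes hol: "f holomorphic_on upper_half_plane" and y: "y > 0"
    and B: "\<And>w. Im w \<ge> y \<Longrightarrow> cmod (f w) \<le> B" and z: "Im z > 0"
  shows "integrable lborel (\<lambda>t. poisson z t * slice f y t)"
    and "(LINT t|lborel. poisson z t * slice f y t) = f (z + \<i> * of_real y)"
proof -
  have *: "(\<lambda>w. f (w + \<i> * of_real y)) holomorphic_on {w. Im w > -y}"
    by (rule holomorphic_on_compose_gen[OF _ hol, unfolded o_def])
       (auto intro!: holomorphic_intros simp: upper_half_plane_def)
  have e: "slice f y t = f (of_real t + \<i> * of_real y)" for t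
    by (simp add: slice_def Complex_eq)
  show "integrable lborel (\<lambda>t. poisson z t * slice f y t)"
    "(LINT t|lborel. poisson z t * slice f y t) = f (z + \<i> * of_real y)"
    unfolding e by (rule poisson_formula_bounded[OF * y B z]; simp)+
qed

lemma hardy2_poisson_slice:
  assumes f: "f \<in> hardy2" and y: "y > 0" and z: "Im z > 0"
  shows "(LINT t|lborel. poisson z t * slice f y t) = f (z + \<i> * of_real y)"
proof -
  obtain B where "\<And>z. Im z \<ge> y \<Longrightarrow> cmod (f z) \<le> B"
    using hardy2_bounded[OF f y] by blast
  from poisson_formula_slice(2)[OF hardy2_holomorphic[OF f] y this z] show ?thesis by blast
qed

lemma hardy2_slice_semigroup:
  assumes f: "f \<in> hardy2" and y: "y > 0" and s: "s > 0"
  shows "slice f (y + s) x = (LINT t|lborel. poisson (Complex x s) t * slice f y t)"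
proof -
  have "Complex x s + \<i> * of_real y = Complex x (y + s)" by (simp add: complex_eq_iff)
  then show ?thesis using hardy2_poisson_slice[OF f y, of "Complex x s"] s by (simp add: slice_def)
qed

text \<open>
  By the semigroup property and the symmetry of the Poisson kernel, height can be moved from one factor of
  the inner product to the other, so that it depends only on the sum of the two heights.
\<close>

lemma hardy2_gram_midpoint:
  assumes f: "f \<in> hardy2" and y: "y > 0" "y' > 0"
  shows "Re (LINT x|lborel. slice f y x * cnj (slice f y' x)) = sqnorm (slice f ((y + y') / 2))"
  using y
proof (induction y y' rule: linorder_wlog)
  case (le y y')
  define s where "s = (y' - y) / 2"
  define m where "m = (y + y') / 2"
  have mL: "slice f m \<in> L2" "slice f y \<in> L2" using le by (auto simp: m_def intro!: hardy2_slice_L2[OF f])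
  have "(LINT x|lborel. slice f y x * cnj (slice f y' x)) = (LINT x|lborel. slice f m x * cnj (slice f m x))"
  proof (cases "s > 0")
    case True
    have e: "y' = m + s" "m = y + s" "m > 0" using le by (auto simp: m_def s_def field_simps)
    have sg: "slice f y' x = (LINT t|lborel. poisson (Complex x s) t * slice f m t)"
      "slice f m x = (LINT t|lborel. poisson (Complex x s) t * slice f y t)" for x
      using hardy2_slice_semigroup[OF f e(3) True] hardy2_slice_semigroup[OF f le(2) True] e(1,2)
      by (simp_all only:)
    show ?thesis
      unfolding sg(1) poisson_selfadjoint[OF mL(2,1) True, symmetric] sg(2)[symmetric] ..
  next
    case False
    then show ?thesis using le by (simp add: s_def m_def)
  qed
  also have "\<dots> = (LINT x|lborel. of_real ((cmod (slice f m x))\<^sup>2))"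
    by (simp only: complex_norm_square)
  also have "\<dots> = of_real (sqnorm (slice f m))"
    unfolding sqnorm_def by (rule integral_complex_of_real)
  finally show ?case by (simp add: m_def)
next
  case (sym y y')
  have "Re (LINT x|lborel. slice f y x * cnj (slice f y' x)) = Re (cnj (LINT x|lborel. slice f y x * cnj (slice f y' x)))"
    by simp
  also have "cnj (LINT x|lborel. slice f y x * cnj (slice f y' x)) = (LINT x|lborel. slice f y' x * cnj (slice f y x))"
    by (subst Bochner_Integration.integral_cnj[symmetric]) (simp add: mult.commute)
  finally show ?case using sym by (simp add: add.commute)
qed

lemma hardy2_sqnorm_slice_diff:
  assumes f: "f \<in> hardy2" and y: "y > 0" "y' > 0"
  shows "sqnorm (\<lambda>x. slice f y x - slice f y' x) =
    sqnorm (slice f y) + sqnorm (slice f y') - 2 * sqnorm (slice f ((y + y') / 2))"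
  using sqnorm_diff[of "slice f y" "slice f y'"] hardy2_gram_midpoint[OF f y] hardy2_slice_L2[OF f] y by simp

text \<open>
  The previous identity makes the squared norm midpoint convex as a function of the height. A convex
  function that increases somewhere grows at least linearly, but this one is bounded.
\<close>

lemma hardy2_sqnorm_antimono:
  assumes f: "f \<in> hardy2" and y: "0 < y" "y \<le> y'"
  shows "sqnorm (slice f y') \<le> sqnorm (slice f y)"
proof (rule ccontr)
  define N where "N y = sqnorm (slice f y)" for y
  obtain M where M: "\<And>y. y > 0 \<Longrightarrow> N y \<le> M"
    unfolding N_def by (rule hardy2_slices[OF f]) blast
  have conv: "2 * N ((u + v) / 2) \<le> N u + N v" if "u > 0" "v > 0" for u v
    using hardy2_sqnorm_slice_diff[OF f that] sqnorm_nonneg[of "\<lambda>x. slice f u x - slice f v x"]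
    by (simp add: N_def)
  assume "\<not> ?thesis"
  then have D: "N y' - N y > 0" by (simp add: N_def)
  define h where "h = y' - y"
  have h: "h \<ge> 0" using y by (simp add: h_def)
  have inc: "N (y + real (Suc n) * h) - N (y + real n * h) \<ge> N y' - N y" for n
  proof (induction n)
    case 0
    then show ?case by (simp add: h_def)
  next
    case (Suc n)
    have "(y + real n * h + (y + real (Suc (Suc n)) * h)) / 2 = y + real (Suc n) * h"
      by (simp add: field_simps)
    moreover have "y + real n * h > 0" "y + real (Suc (Suc n)) * h > 0" using y h by (simp_all add: add_pos_nonneg)
    ultimately have "2 * N (y + real (Suc n) * h) \<le> N (y + real n * h) + N (y + real (Suc (Suc n)) * h)"
      using conv[of "y + real n * h" "y + real (Suc (Suc n)) * h"] by (simp only:)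
    then show ?case using Suc by simp
  qed
  have lin: "N (y + real n * h) \<ge> N y + real n * (N y' - N y)" for n
  proof (induction n)
    case (Suc n)
    then show ?case using inc[of n] by (simp add: algebra_simps)
  qed simp
  \<comment> \<open>The increments never decrease, so \<open>N\<close> outgrows its bound \<open>M\<close>.\<close>
  obtain n where n: "M - N y < real n * (N y' - N y)" using reals_Archimedean3[OF D] by blast
  have "N (y + real n * h) \<le> M" by (intro M) (use y h in \<open>simp add: add_pos_nonneg\<close>)
  then show False using lin[of n] n by linarith
qed

text \<open>
  As the height decreases to zero the squared norms increase to their finite supremum; the identity for
  \<open>sqnorm\<close> of a difference then bounds the distance of two slices by the distance from that supremum.
\<close>

lemma hardy2_slices_cauchy:
  assumes f: "f \<in> hardy2" and e: "e > 0"
  obtains d where "d > 0"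
    "\<And>y y'. 0 < y \<Longrightarrow> y < d \<Longrightarrow> 0 < y' \<Longrightarrow> y' < d \<Longrightarrow> sqnorm (\<lambda>x. slice f y x - slice f y' x) \<le> e"
proof -
  define N where "N y = sqnorm (slice f y)" for y
  obtain M where M: "\<And>y. y > 0 \<Longrightarrow> N y \<le> M"
    unfolding N_def by (rule hardy2_slices[OF f]) blast
  define L where "L = (SUP y\<in>{0<..}. N y)"
  have bdd: "bdd_above (N ` {0<..})" using M by (intro bdd_aboveI2[where M=M]) auto
  have L: "N y \<le> L" if "y > 0" for y unfolding L_def using bdd that by (intro cSUP_upper) auto
  have "L - e / 2 < L" using e by simp
  then obtain d where d: "d > 0" "L - e / 2 < N d"
    using less_cSUP_iff[OF _ bdd, of "L - e / 2"] unfolding L_def by auto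
  show ?thesis
  proof (rule that[OF d(1)])
    fix y y' assume y: "0 < y" "y < d" "0 < y'" "y' < d"
    have "N d \<le> N ((y + y') / 2)"
      unfolding N_def by (rule hardy2_sqnorm_antimono[OF f]) (use y in auto)
    then show "sqnorm (\<lambda>x. slice f y x - slice f y' x) \<le> e"
      using hardy2_sqnorm_slice_diff[OF f y(1,3)] L[OF y(1)] L[OF y(3)] d(2) by (simp add: N_def)
  qed
qed

section \<open>The maximal inequality for Poisson integrals\<close>

lemma emeasure_UN_le_nn_integral_count_space:
  assumes C: "countable C" and [measurable]: "\<And>i. i \<in> C \<Longrightarrow> X i \<in> sets M"
  shows "emeasure M (\<Union>i\<in>C. X i) \<le> (\<integral>\<^sup>+i. emeasure M (X i) \<partial>count_space C)"
proof -
  have [measurable]: "(\<Union>i\<in>C. X i) \<in> sets M" using C by auto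
  have "emeasure M (\<Union>i\<in>C. X i) = (\<integral>\<^sup>+x. indicator (\<Union>i\<in>C. X i) x \<partial>M)" by simp
  also have "\<dots> \<le> (\<integral>\<^sup>+x. (\<integral>\<^sup>+i. indicator (X i) x \<partial>count_space C) \<partial>M)"
  proof (intro nn_integral_mono)
    fix x
    show "indicator (\<Union>i\<in>C. X i) x \<le> (\<integral>\<^sup>+i. indicator (X i) x \<partial>count_space C)"
    proof (cases "x \<in> (\<Union>i\<in>C. X i)")
      case True
      then obtain i where i: "i \<in> C" "x \<in> X i" by blast
      have "indicator (X i) x \<le> (\<integral>\<^sup>+i. indicator (X i) x \<partial>count_space C)"
        using nn_integral_ge_point[OF i(1), of "\<lambda>i. indicator (X i) x"] .
      then show ?thesis using True i by simp
    qed auto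
  qed
  also have "\<dots> = (\<integral>\<^sup>+i. (\<integral>\<^sup>+x. indicator (X i) x \<partial>M) \<partial>count_space C)"
    by (intro nn_integral_count_space_nn_integral C) auto
  also have "\<dots> = (\<integral>\<^sup>+i. emeasure M (X i) \<partial>count_space C)"
    by (intro nn_integral_cong) auto
  finally show ?thesis .
qed

text \<open>
  Take the least \<open>k\<close> that satisfies the first condition; its minimality bounds \<open>t - Re z\<close> from below.
\<close>

lemma poisson_le_dyadic:
  assumes z: "Im z > 0"
  shows "\<exists>k. \<bar>t - Re z\<bar> \<le> 2 ^ k * Im z \<and> poisson z t \<le> 4 * (1/4) ^ k / Im z"
proof -
  define y where "y = Im z"
  have y: "y > 0" using z by (simp add: y_def)
  obtain n where "\<bar>t - Re z\<bar> / y < 2 ^ n" using real_arch_pow[of 2] by auto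
  then have ex: "\<exists>k. \<bar>t - Re z\<bar> \<le> 2 ^ k * y" using y by (intro exI[of _ n]) (simp add: field_simps)
  define k where "k = (LEAST k. \<bar>t - Re z\<bar> \<le> 2 ^ k * y)"
  have k: "\<bar>t - Re z\<bar> \<le> 2 ^ k * y" unfolding k_def using ex by (rule LeastI_ex)
  have "poisson z t \<le> 4 * (1/4) ^ k / y"
  proof (cases k)
    case 0
    have "poisson z t \<le> 1 / (pi * y)" using poisson_le[OF z] by (simp add: y_def)
    also have "\<dots> \<le> 4 / y" using y pi_ge_two by (simp add: field_simps)
    finally show ?thesis using 0 by simp
  next
    case (Suc j)
    have "\<not> \<bar>t - Re z\<bar> \<le> 2 ^ j * y"
      using not_less_Least[of j "\<lambda>k. \<bar>t - Re z\<bar> \<le> 2 ^ k * y"] Suc unfolding k_def by simp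
    then have "(2 ^ j * y)\<^sup>2 \<le> (t - Re z)\<^sup>2"
      using y by (subst power2_abs[of "t - Re z", symmetric]) (intro power_mono; simp)
    moreover have "(2 ^ j * y)\<^sup>2 = 4 ^ j * y\<^sup>2"
      by (induction j) (simp_all add: power2_eq_square)
    ultimately have "4 ^ j * y\<^sup>2 \<le> 1 * ((t - Re z)\<^sup>2 + y\<^sup>2)" by (simp add: add_increasing2)
    also have "\<dots> \<le> pi * ((t - Re z)\<^sup>2 + y\<^sup>2)" using pi_ge_two by (intro mult_right_mono) auto
    finally have "poisson z t \<le> y / (4 ^ j * y\<^sup>2)"
      unfolding poisson_def cmod_real_diff_sq using y by (auto simp: y_def intro!: divide_left_mono mult_pos_pos add_nonneg_pos)
    also have "\<dots> = 4 * (1/4) ^ k / y" using y Suc by (simp add: power2_eq_square field_simps power_one_over)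
    finally show ?thesis .
  qed
  then show ?thesis using k by (auto simp: y_def)
qed

text \<open>
  At the dyadic scale \<open>k\<close> the kernel is of order \<open>(1/4) ^ k / Im z\<close> and the mass of \<open>v\<close> at most
  \<open>m * 2 ^ k * Im z\<close>, so the contributions of the scales form a geometric series.
\<close>

lemma poisson_le_of_averages:
  assumes z: "Im z > 0" and v[measurable]: "v \<in> borel_measurable borel" and m: "m \<ge> 0"
    and av: "\<And>k::nat. (\<integral>\<^sup>+t. v t * indicator (cball (Re z) (2 ^ k * Im z)) t \<partial>lborel) \<le> ennreal (m * (2 ^ k * Im z))"
  shows "(\<integral>\<^sup>+t. ennreal (poisson z t) * v t \<partial>lborel) \<le> ennreal (8 * m)"
proof -
  define c where "c k = 4 * (1/4) ^ k / Im z" for k :: nat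
  have c: "c k \<ge> 0" for k using z by (simp add: c_def)
  let ?B = "\<lambda>k. cball (Re z) (2 ^ k * Im z)"
  have [measurable]: "?B k \<in> sets borel" for k by (intro borel_closed closed_cball)
  have "(\<integral>\<^sup>+t. ennreal (poisson z t) * v t \<partial>lborel) \<le> (\<integral>\<^sup>+t. (\<Sum>k. ennreal (c k) * (v t * indicator (?B k) t)) \<partial>lborel)"
  proof (intro nn_integral_mono)
    fix t
    obtain k where k: "\<bar>t - Re z\<bar> \<le> 2 ^ k * Im z" "poisson z t \<le> c k"
      using poisson_le_dyadic[OF z] unfolding c_def by blast
    have "ennreal (poisson z t) * v t \<le> ennreal (c k) * (v t * indicator (?B k) t)"
      using k by (auto simp: dist_real_def abs_minus_commute indicator_def intro!: mult_right_mono ennreal_leI)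
    also have "\<dots> = (\<Sum>i\<in>{k}. ennreal (c i) * (v t * indicator (?B i) t))" by simp
    also have "\<dots> \<le> (\<Sum>i. ennreal (c i) * (v t * indicator (?B i) t))"
      by (intro sum_le_suminf summableI) auto
    finally show "ennreal (poisson z t) * v t \<le> (\<Sum>k. ennreal (c k) * (v t * indicator (?B k) t))" .
  qed
  also have "\<dots> = (\<Sum>k. ennreal (c k) * (\<integral>\<^sup>+t. v t * indicator (?B k) t \<partial>lborel))"
    by (simp add: nn_integral_suminf nn_integral_cmult)
  also have "\<dots> \<le> (\<Sum>k. ennreal (c k) * ennreal (m * (2 ^ k * Im z)))"
    by (intro suminf_le summableI mult_left_mono av) auto
  also have "\<dots> = (\<Sum>k. ennreal (4 * m * (1/2) ^ k))"
  proof (intro suminf_cong)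
    fix k :: nat
    have "c k * (m * (2 ^ k * Im z)) = 4 * m * ((1/4) ^ k * 2 ^ k)" using z by (simp add: c_def)
    also have "(1/4::real) ^ k * 2 ^ k = (1/2) ^ k" by (simp flip: power_mult_distrib)
    finally show "ennreal (c k) * ennreal (m * (2 ^ k * Im z)) = ennreal (4 * m * (1/2) ^ k)"
      using c z m by (simp add: ennreal_mult[symmetric])
  qed
  also have "\<dots> = ennreal (8 * m)"
  proof (rule suminf_ennreal_eq)
    have "(\<lambda>k. 4 * m * (1/2) ^ k) sums (4 * m * (1 / (1 - 1/2)))"
      by (intro sums_mult geometric_sums) auto
    then show "(\<lambda>k. 4 * m * (1/2) ^ k) sums (8 * m)" by simp
  qed (use m in auto)
  finally show ?thesis .
qed

text \<open>
  The Hardy-Littlewood argument. A point \<open>z\<close> where the Poisson integral exceeds \<open>lam\<close> has, at one of the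
  dyadic scales \<open>2 ^ k * Im z\<close>, an interval on which the average of \<open>v\<close> is at least a fixed multiple of \<open>lam\<close>. Vitali's
  covering lemma, applied to these intervals enlarged by the factor \<open>a\<close>, selects disjoint ones whose
  fivefold enlargements cover the union.
  
  A real number \<open>x\<close> lies in \<open>ball (Re z) (a * Im z)\<close> iff \<open>z\<close> lies in the cone of aperture \<open>a\<close> at \<open>x\<close>: the
  union is the set where the non-tangential maximal function is large.
\<close>

lemma poisson_maximal_inequality:
  assumes v[measurable]: "v \<in> borel_measurable borel" and I: "(\<integral>\<^sup>+t. v t \<partial>lborel) \<le> ennreal I" "I \<ge> 0"
    and lam: "lam > 0" and a: "a \<ge> 1"
    and Z: "\<And>z. z \<in> Z \<Longrightarrow> Im z > 0" "\<And>z. z \<in> Z \<Longrightarrow> ennreal lam < (\<integral>\<^sup>+t. ennreal (poisson z t) * v t \<partial>lborel)"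
  shows "emeasure lborel (\<Union>z\<in>Z. ball (Re z) (a * Im z)) \<le> ennreal (80 * a * I / lam)"
proof -
  \<comment> \<open>If every dyadic average were at most \<open>m\<close>, the Poisson integral would be at most \<open>8 * m = lam\<close>.\<close>
  define m where "m = lam / 8"
  have m: "m > 0" using lam by (simp add: m_def)
  have "\<exists>k::nat. ennreal (m * (2 ^ k * Im z)) < (\<integral>\<^sup>+t. v t * indicator (cball (Re z) (2 ^ k * Im z)) t \<partial>lborel)"
    if "z \<in> Z" for z
  proof (rule ccontr)
    assume "\<not> ?thesis"
    then have "(\<integral>\<^sup>+t. ennreal (poisson z t) * v t \<partial>lborel) \<le> ennreal (8 * m)"
      using m by (intro poisson_le_of_averages Z(1)[OF that]) (auto simp: not_less)
    then show False using Z(2)[OF that] by (simp add: m_def)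
  qed
  then obtain k where k: "\<And>z. z \<in> Z \<Longrightarrow> ennreal (m * (2 ^ k z * Im z)) <
      (\<integral>\<^sup>+t. v t * indicator (cball (Re z) (2 ^ k z * Im z)) t \<partial>lborel)"
    by metis
  define r where "r z = 2 ^ k z * Im z" for z
  let ?\<nu> = "density lborel v"
  have nu: "emeasure ?\<nu> A = (\<integral>\<^sup>+t. v t * indicator A t \<partial>lborel)" if "A \<in> sets borel" for A
    using that by (simp add: emeasure_density)
  have nu_le: "emeasure ?\<nu> A \<le> ennreal I" if "A \<in> sets borel" for A
    unfolding nu[OF that] by (rule order_trans[OF nn_integral_mono I(1)]) (auto simp: indicator_def)
  have r: "r z > 0" "Im z \<le> r z" "ennreal (m * r z) \<le> emeasure ?\<nu> (cball (Re z) (r z))" if "z \<in> Z" for z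
    using Z(1)[OF that] k[OF that] by (auto simp: r_def nu less_imp_le intro: mult_right_mono[of 1 "2 ^ k z", simplified])
  have rI: "r z \<le> I / m" if "z \<in> Z" for z
    using order_trans[OF r(3)[OF that] nu_le] I(2) m by (simp add: field_simps)
  obtain C where C: "countable C" "C \<subseteq> Z"
     "pairwise (\<lambda>i j. disjnt (cball (Re i) (a * r i)) (cball (Re j) (a * r j))) C"
     "(\<Union>z\<in>Z. cball (Re z) (a * r z)) \<subseteq> (\<Union>i\<in>C. cball (Re i) (5 * (a * r i)))"
  proof (rule Vitali_covering_lemma_cballs[where a=Re and r="\<lambda>z. a * r z", OF order_refl])
    show "0 < a * r z \<and> a * r z \<le> a * (I / m)" if "z \<in> Z" for z
      using r(1)[OF that] mult_left_mono[OF rI[OF that], of a] a by simp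
  qed blast
  have "emeasure lborel (\<Union>z\<in>Z. ball (Re z) (a * Im z)) \<le> emeasure lborel (\<Union>i\<in>C. cball (Re i) (5 * (a * r i)))"
  proof (rule emeasure_mono)
    have "ball (Re z) (a * Im z) \<subseteq> cball (Re z) (a * r z)" if "z \<in> Z" for z
      using mult_left_mono[OF r(2)[OF that], of a] a by (intro order_trans[OF ball_subset_cball subset_cball]) auto
    then show "(\<Union>z\<in>Z. ball (Re z) (a * Im z)) \<subseteq> (\<Union>i\<in>C. cball (Re i) (5 * (a * r i)))"
      using C(4) by blast
    show "(\<Union>i\<in>C. cball (Re i) (5 * (a * r i))) \<in> sets lborel" using C(1) by auto
  qed
  also have "\<dots> \<le> (\<integral>\<^sup>+i. emeasure lborel (cball (Re i) (5 * (a * r i))) \<partial>count_space C)"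
    by (rule emeasure_UN_le_nn_integral_count_space[OF C(1)]) simp
  also have "\<dots> \<le> (\<integral>\<^sup>+i. ennreal (10 * a / m) * emeasure ?\<nu> (cball (Re i) (r i)) \<partial>count_space C)"
  proof (intro nn_integral_mono)
    fix i assume "i \<in> space (count_space C)"
    then have i: "i \<in> Z" using C(2) by auto
    have "emeasure lborel (cball (Re i) (5 * (a * r i))) = ennreal (10 * a / m * (m * r i))"
      using r(1)[OF i] a m by (simp add: cball_eq_atLeastAtMost)
    also have "\<dots> = ennreal (10 * a / m) * ennreal (m * r i)"
      using r(1)[OF i] a m by (intro ennreal_mult) auto
    also have "\<dots> \<le> ennreal (10 * a / m) * emeasure ?\<nu> (cball (Re i) (r i))"
      by (intro mult_left_mono r(3)[OF i]) auto
    finally show "emeasure lborel (cball (Re i) (5 * (a * r i))) \<le> ennreal (10 * a / m) * emeasure ?\<nu> (cball (Re i) (r i))" .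
  qed
  also have "\<dots> = ennreal (10 * a / m) * (\<integral>\<^sup>+i. emeasure ?\<nu> (cball (Re i) (r i)) \<partial>count_space C)"
    by (rule nn_integral_cmult) auto
  also have "(\<integral>\<^sup>+i. emeasure ?\<nu> (cball (Re i) (r i)) \<partial>count_space C) = emeasure ?\<nu> (\<Union>i\<in>C. cball (Re i) (r i))"
  proof (rule emeasure_UN_countable[symmetric])
    show "disjoint_family_on (\<lambda>i. cball (Re i) (r i)) C"
      unfolding disjoint_family_on_def
    proof (intro ballI impI)
      fix i j assume ij: "i \<in> C" "j \<in> C" "i \<noteq> j"
      have sub: "cball (Re i) (r i) \<subseteq> cball (Re i) (a * r i)" if "i \<in> C" for i
        using r(1)[of i] that C(2) a by (intro subset_cball) (auto simp: mult_le_cancel_right1)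
      show "cball (Re i) (r i) \<inter> cball (Re j) (r j) = {}"
        using C(3) ij sub[OF ij(1)] sub[OF ij(2)] unfolding pairwise_def disjnt_def by blast
    qed
  qed (use C in auto)
  also have "ennreal (10 * a / m) * emeasure ?\<nu> (\<Union>i\<in>C. cball (Re i) (r i)) \<le> ennreal (10 * a / m) * ennreal I"
    by (intro mult_left_mono nu_le) (use C(1) in auto)
  also have "\<dots> = ennreal (80 * a * I / lam)"
    using a m I(2) by (simp add: ennreal_mult[symmetric] m_def)
  finally show ?thesis .
qed

section \<open>Non-tangential boundary values\<close>

text \<open>
  On the line at height \<open>h\<close> the difference is the \<open>L2\<close> function \<open>slice f h - slice f (h + s)\<close>, so the
  maximal inequality applies above that line. Letting \<open>h\<close> tend to zero exhausts the half-plane; the bound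
  does not depend on \<open>h\<close>.
\<close>

lemma hardy2_vertical_difference_maximal:
  assumes f: "f \<in> hardy2" and a: "a \<ge> 1" and lam: "lam > 0" and e: "e \<ge> 0"
    and d: "0 < s" "2 * s < d"
    and le: "\<And>y y'. 0 < y \<Longrightarrow> y < d \<Longrightarrow> 0 < y' \<Longrightarrow> y' < d \<Longrightarrow> sqnorm (\<lambda>x. slice f y x - slice f y' x) \<le> e"
  shows "emeasure lborel (\<Union>z\<in>{z. Im z > 0 \<and> lam < (cmod (f z - f (z + \<i> * of_real s)))\<^sup>2}. ball (Re z) (a * Im z))
      \<le> ennreal (160 * a * e / lam)"
proof -
  define W where "W h = {z. Im z > 2 * h \<and> lam < (cmod (f z - f (z + \<i> * of_real s)))\<^sup>2}" for h
  define E where "E h = (\<Union>z\<in>W h. ball (Re z) (a * Im z))" for h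
  \<comment> \<open>Less than \<open>d / 2\<close>, so that \<open>h n + s < d\<close> stays in the range of the hypothesis on differences.\<close>
  define h where "h n = d / (4 * real (Suc n))" for n
  have d0: "d > 0" using d by simp
  have h: "h n > 0" "h n < d / 2" for n
    using d0 by (auto simp: h_def field_simps intro!: add_pos_nonneg)
  have E: "open (E h)" for h unfolding E_def by auto
  have bound: "emeasure lborel (E h) \<le> ennreal (160 * a * e / lam)" if h: "0 < h" "h < d / 2" for h
  proof -
    define u where "u x = slice f h x - slice f (h + s) x" for x
    have sl: "slice f h \<in> L2" "slice f (h + s) \<in> L2" using hardy2_slice_L2[OF f] h d by simp_all
    have u: "u \<in> L2" unfolding u_def by (rule L2_diff[OF sl])
    have ue: "sqnorm u \<le> e" unfolding u_def using h d by (intro le) auto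
    note [measurable] = L2_measurable[OF u]
    \<comment> \<open>Lowering \<open>z\<close> by \<open>h\<close> at most halves its height when \<open>Im z > 2 * h\<close>; hence the aperture \<open>2 * a\<close> below.\<close>
    define Z where "Z = (\<lambda>z. z - \<i> * of_real h) ` W h"
    have "E h \<subseteq> (\<Union>z\<in>Z. ball (Re z) ((2 * a) * Im z))"
    proof -
      have "ball (Re z) (a * Im z) \<subseteq> ball (Re (z - \<i> * of_real h)) ((2 * a) * Im (z - \<i> * of_real h))" if "z \<in> W h" for z
      proof -
        have "a * Im z \<le> a * (2 * (Im z - h))" using that a by (intro mult_left_mono) (auto simp: W_def)
        then show ?thesis by (auto simp: algebra_simps)
      qed
      then show ?thesis unfolding E_def Z_def by blast
    qed
    then have "emeasure lborel (E h) \<le> emeasure lborel (\<Union>z\<in>Z. ball (Re z) ((2 * a) * Im z))"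
      by (intro emeasure_mono) (auto intro!: borel_open)
    also have "\<dots> \<le> ennreal (80 * (2 * a) * e / lam)"
    proof (rule poisson_maximal_inequality[where v="\<lambda>t. ennreal ((cmod (u t))\<^sup>2)"])
      show "(\<integral>\<^sup>+t. ennreal ((cmod (u t))\<^sup>2) \<partial>lborel) \<le> ennreal e"
        using ue by (simp add: nn_integral_eq_sqnorm[OF u] ennreal_leI)
      fix z assume "z \<in> Z"
      then have zW: "z + \<i> * of_real h \<in> W h" unfolding Z_def by auto
      then show z: "Im z > 0" using h by (simp add: W_def)
      have "(LINT t|lborel. poisson z t * u t) =
          (LINT t|lborel. poisson z t * slice f h t) - (LINT t|lborel. poisson z t * slice f (h + s) t)"
        unfolding u_def right_diff_distrib
        by (intro Bochner_Integration.integral_diff poisson_L2_integrable sl z)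
      also have "\<dots> = f (z + \<i> * of_real h) - f ((z + \<i> * of_real h) + \<i> * of_real s)"
        using hardy2_poisson_slice[OF f _ z, of h] hardy2_poisson_slice[OF f _ z, of "h + s"] h d
        by (simp add: algebra_simps)
      finally have "lam < (cmod (LINT t|lborel. poisson z t * u t))\<^sup>2"
        using zW by (simp add: W_def)
      also have "\<dots> \<le> (LINT t|lborel. poisson z t * (cmod (u t))\<^sup>2)"
        by (rule poisson_L2_jensen[OF u z])
      finally have "ennreal lam < ennreal (LINT t|lborel. poisson z t * (cmod (u t))\<^sup>2)"
        using lam by (simp add: ennreal_less_iff)
      also have "\<dots> = (\<integral>\<^sup>+t. ennreal (poisson z t * (cmod (u t))\<^sup>2) \<partial>lborel)"
        using poisson_nonneg[OF z] by (intro nn_integral_eq_integral[symmetric] poisson_L2_integrable[OF u z]) auto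
      also have "\<dots> = (\<integral>\<^sup>+t. ennreal (poisson z t) * ennreal ((cmod (u t))\<^sup>2) \<partial>lborel)"
        using poisson_nonneg[OF z] by (intro nn_integral_cong ennreal_mult) auto
      finally show "ennreal lam < \<dots>" .
    qed (use e a lam in auto)
    finally show ?thesis by simp
  qed
  have "(\<Union>z\<in>{z. Im z > 0 \<and> lam < (cmod (f z - f (z + \<i> * of_real s)))\<^sup>2}. ball (Re z) (a * Im z)) \<subseteq> (\<Union>n. E (h n))"
  proof clarify
    fix z x assume z: "Im z > 0" "lam < (cmod (f z - f (z + \<i> * of_real s)))\<^sup>2" and x: "x \<in> ball (Re z) (a * Im z)"
    obtain n where "inverse (real (Suc n)) < Im z / d" using reals_Archimedean[of "Im z / d"] z d0 by auto
    then have "2 * h n < Im z" using d0 z by (simp add: h_def field_simps)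
    then show "x \<in> (\<Union>n. E (h n))" using z x by (auto simp: E_def W_def)
  qed
  then have "emeasure lborel (\<Union>z\<in>{z. Im z > 0 \<and> lam < (cmod (f z - f (z + \<i> * of_real s)))\<^sup>2}. ball (Re z) (a * Im z))
      \<le> emeasure lborel (\<Union>n. E (h n))"
    using E by (intro emeasure_mono) auto
  also have "\<dots> = (SUP n. emeasure lborel (E (h n)))"
  proof (rule SUP_emeasure_incseq[symmetric])
    show "incseq (\<lambda>n. E (h n))"
    proof (rule incseq_SucI)
      fix n
      have "h (Suc n) \<le> h n" using d0 by (auto simp: h_def field_simps)
      then show "E (h n) \<subseteq> E (h (Suc n))" unfolding E_def W_def by force
    qed
  qed (use E in auto)
  also have "\<dots> \<le> ennreal (160 * a * e / lam)"
    by (intro SUP_least bound h)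
  finally show ?thesis .
qed

text \<open>
  Off a small set \<open>f\<close> differs by at most \<open>lam / 3\<close> in the whole cone at \<open>x\<close> from a vertical translate of
  itself, which is continuous at \<open>x\<close>. The exceptional sets can be made arbitrarily small, so their
  intersection is null.
\<close>

lemma hardy2_small_nontangential_oscillation:
  assumes f: "f \<in> hardy2" and a: "a \<ge> 1" and lam: "lam > 0"
  shows "AE x in lborel. \<exists>r>0. \<forall>z z'. \<bar>Re z - x\<bar> < a * Im z \<and> \<bar>Re z' - x\<bar> < a * Im z' \<and>
    dist z (of_real x) < r \<and> dist z' (of_real x) < r \<longrightarrow> cmod (f z - f z') < lam"
proof -
  define mu where "mu = (lam / 3)\<^sup>2"
  have mu: "mu > 0" using lam by (simp add: mu_def)
  define bad where "bad s = (\<Union>z\<in>{z. Im z > 0 \<and> mu < (cmod (f z - f (z + \<i> * of_real s)))\<^sup>2}. ball (Re z) (a * Im z))" for s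
  have "\<exists>s>0. emeasure lborel (bad s)
      \<le> ennreal (160 * a * (1 / real (Suc n)) / mu)" for n
  proof -
    obtain d where d: "d > 0" "\<And>y y'. 0 < y \<Longrightarrow> y < d \<Longrightarrow> 0 < y' \<Longrightarrow> y' < d \<Longrightarrow> sqnorm (\<lambda>x. slice f y x - slice f y' x) \<le> 1 / real (Suc n)"
      using hardy2_slices_cauchy[OF f, of "1 / real (Suc n)"] by auto
    show ?thesis
      unfolding bad_def
      by (rule exI[of _ "d / 4"], intro conjI hardy2_vertical_difference_maximal[OF f a mu _ _ _ d(2)]) (use d(1) in auto)
  qed
  then obtain s where s: "\<And>n. s n > 0" "\<And>n. emeasure lborel (bad (s n))
      \<le> ennreal (160 * a * (1 / real (Suc n)) / mu)"
    by metis
  define E where "E n = bad (s n)" for n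
  have E: "open (E n)" for n unfolding E_def bad_def by auto
  define N where "N = (\<Inter>n. E n)"
  have N: "N \<in> sets lborel" unfolding N_def using E by auto
  have "emeasure lborel N \<le> 0"
  proof (rule LIMSEQ_le_const)
    have "(\<lambda>n. 160 * a * (1 / real (Suc n)) / mu) \<longlonglongrightarrow> 0"
      using tendsto_mult_right_zero[OF LIMSEQ_inverse_real_of_nat, of "160 * a / mu"] by (simp add: field_simps)
    then show "(\<lambda>n. ennreal (160 * a * (1 / real (Suc n)) / mu)) \<longlonglongrightarrow> 0"
      using tendsto_ennrealI by fastforce
    show "\<exists>k. \<forall>n\<ge>k. emeasure lborel N \<le> ennreal (160 * a * (1 / real (Suc n)) / mu)"
    proof (intro exI[of _ 0] allI impI)
      fix n
      have "emeasure lborel N \<le> emeasure lborel (E n)" unfolding N_def using E by (intro emeasure_mono) auto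
      then show "emeasure lborel N \<le> ennreal (160 * a * (1 / real (Suc n)) / mu)"
        using s(2)[of n] unfolding E_def by (rule order_trans)
    qed
  qed
  then have "N \<in> null_sets lborel" using N by (simp add: null_sets_def)
  then have "AE x in lborel. x \<notin> N" by (rule AE_not_in)
  then show ?thesis
  proof eventually_elim
    case (elim x)
    then obtain n where n: "x \<notin> E n" by (auto simp: N_def)
    define p where "p = of_real x + \<i> * of_real (s n)"
    have cone: "cmod (f z - f (z + \<i> * of_real (s n))) \<le> lam / 3" if "\<bar>Re z - x\<bar> < a * Im z" for z
    proof -
      have "0 < a * Im z" using that by linarith
      then have "Im z > 0" using a by (simp add: zero_less_mult_iff)
      moreover have "x \<in> ball (Re z) (a * Im z)" using that by (simp add: dist_real_def)
      ultimately have "(cmod (f z - f (z + \<i> * of_real (s n))))\<^sup>2 \<le> (lam / 3)\<^sup>2"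
        using n unfolding E_def bad_def mu_def by (auto simp: not_less dest!: spec[of _ z])
      then show ?thesis by (rule power2_le_imp_le) (use lam in simp)
    qed
    have "isCont f p"
      using hardy2_holomorphic[OF f] open_upper_half_plane s(1)[of n]
      by (intro continuous_on_interior[OF holomorphic_on_imp_continuous_on])
         (auto simp: interior_open upper_half_plane_def p_def)
    then obtain r where r: "r > 0" "\<And>w. dist w p < r \<Longrightarrow> dist (f w) (f p) < lam / 6"
      unfolding continuous_at_eps_delta using lam by (metis divide_pos_pos zero_less_numeral)
    have near: "cmod (f (z + \<i> * of_real (s n)) - f p) < lam / 6" if "dist z (of_real x) < r" for z
      using r(2)[of "z + \<i> * of_real (s n)"] that by (simp add: p_def dist_norm)
    have "cmod (f z - f z') < lam" if "\<bar>Re z - x\<bar> < a * Im z" "\<bar>Re z' - x\<bar> < a * Im z'"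
      "dist z (of_real x) < r" "dist z' (of_real x) < r" for z z'
    proof -
      let ?g = "\<lambda>z. f (z + \<i> * of_real (s n))"
      have "cmod (f z - f z') \<le> cmod (f z - ?g z) + (cmod (?g z - f p) + cmod (?g z' - f p)) + cmod (f z' - ?g z')"
        by norm
      then show ?thesis using cone[OF that(1)] cone[OF that(2)] near[OF that(3)] near[OF that(4)] by linarith
    qed
    then show ?case using r(1) by blast
  qed
qed

lemma tendsto_nontangential_vertical:
  fixes f :: "complex \<Rightarrow> complex"
  assumes "(f \<longlongrightarrow> l) (nontangential x)"
  shows "(\<lambda>n. f (Complex x (1 / real (Suc n)))) \<longlonglongrightarrow> l"
proof -
  have "(f \<longlongrightarrow> l) (at (of_real x) within {z. \<bar>Re z - x\<bar> < 1 * Im z})"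
    using assms unfolding tendsto_nontangential_iff by (meson zero_less_one)
  moreover have "filterlim (\<lambda>n. Complex x (1 / real (Suc n))) (at (of_real x) within {z. \<bar>Re z - x\<bar> < 1 * Im z}) sequentially"
    unfolding filterlim_at
  proof (intro conjI always_eventually allI)
    have "(\<lambda>n. 1 / real (Suc n)) \<longlonglongrightarrow> 0" by real_asymp
    from tendsto_Complex[OF tendsto_const this, of x]
    show "(\<lambda>n. Complex x (1 / real (Suc n))) \<longlonglongrightarrow> of_real x"
      by (simp add: complex_of_real_def)
  qed (auto simp: complex_eq_iff)
  ultimately show ?thesis by (rule filterlim_compose)
qed

text \<open>
  Apply \<open>hardy2_small_nontangential_oscillation\<close> with apertures and oscillations from countable sets;
  almost everywhere the Cauchy criterion then holds in all cones. All of them contain the vertical ray, so the limits agree.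
\<close>

lemma hardy2_nontangential_limit:
  assumes f: "f \<in> hardy2"
  shows "AE x in lborel. \<exists>l. (f \<longlongrightarrow> l) (nontangential x)"
proof -
  have "AE x in lborel. \<forall>n m. \<exists>r>0. \<forall>z z'. \<bar>Re z - x\<bar> < real (Suc n) * Im z \<and> \<bar>Re z' - x\<bar> < real (Suc n) * Im z' \<and>
    dist z (of_real x) < r \<and> dist z' (of_real x) < r \<longrightarrow> cmod (f z - f z') < 1 / real (Suc m)"
    unfolding AE_all_countable
    by (intro allI hardy2_small_nontangential_oscillation[OF f]) auto
  then show ?thesis
  proof eventually_elim
    case (elim x)
    define p where "p n = Complex x (1 / real (Suc n))" for n
    have "(\<lambda>n. 1 / real (Suc n)) \<longlonglongrightarrow> 0" by real_asymp
    from tendsto_Complex[OF tendsto_const this, of x]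
    have p: "p \<longlonglongrightarrow> of_real x" unfolding p_def by (simp add: complex_of_real_def)
    have osc: "\<exists>r>0. \<forall>z. \<bar>Re z - x\<bar> < a * Im z \<and> dist z (of_real x) < r \<longrightarrow>
        (\<forall>\<^sub>F k in sequentially. cmod (f z - f (p k)) < e)" if e: "e > 0" and a: "a > 0" for a e
    proof -
      obtain n where n: "a \<le> real n" using real_arch_simple by blast
      obtain m where m: "1 / real (Suc m) < e" using reals_Archimedean[OF e] by (auto simp: inverse_eq_divide)
      obtain r where r: "r > 0" "\<And>z z'. \<bar>Re z - x\<bar> < real (Suc n) * Im z \<Longrightarrow> \<bar>Re z' - x\<bar> < real (Suc n) * Im z' \<Longrightarrow>
        dist z (of_real x) < r \<Longrightarrow> dist z' (of_real x) < r \<Longrightarrow> cmod (f z - f z') < 1 / real (Suc m)"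
        using elim by metis
      show ?thesis
      proof (intro exI[of _ r] conjI r(1) allI impI)
        fix z assume z: "\<bar>Re z - x\<bar> < a * Im z \<and> dist z (of_real x) < r"
        have c: "\<bar>Re z - x\<bar> < real (Suc n) * Im z"
        proof -
          have "0 < a * Im z" using z by linarith
          then have "Im z > 0" using a by (simp add: zero_less_mult_iff)
          then have "a * Im z \<le> real (Suc n) * Im z" using n by (intro mult_right_mono) auto
          then show ?thesis using z by linarith
        qed
        have "\<forall>\<^sub>F k in sequentially. dist (p k) (of_real x) < r"
          using p r(1) by (rule tendstoD)
        then show "\<forall>\<^sub>F k in sequentially. cmod (f z - f (p k)) < e"
        proof eventually_elim
          case (elim k)
          have "cmod (f z - f (p k)) < 1 / real (Suc m)"
            using c z elim by (intro r(2)) (auto simp: p_def)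
          then show ?case using m by simp
        qed
      qed
    qed
    have "Cauchy (\<lambda>n. f (p n))"
    proof (rule metric_CauchyI)
      fix e :: real assume e: "e > 0"
      obtain r where r: "r > 0" "\<And>z z'. \<bar>Re z - x\<bar> < 1 * Im z \<Longrightarrow> dist z (of_real x) < r \<Longrightarrow>
         (\<forall>\<^sub>F k in sequentially. cmod (f z - f (p k)) < e / 2)" using osc[of "e / 2" 1] e by auto
      obtain K where K: "\<And>k. k \<ge> K \<Longrightarrow> dist (p k) (of_real x) < r"
        using tendstoD[OF p r(1)] unfolding eventually_sequentially by blast
      have ev: "\<forall>\<^sub>F k in sequentially. cmod (f (p i) - f (p k)) < e / 2" if "i \<ge> K" for i
        using r(2)[of "p i"] K[OF that] by (auto simp: p_def)
      show "\<exists>M. \<forall>m\<ge>M. \<forall>n\<ge>M. dist (f (p m)) (f (p n)) < e"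
      proof (intro exI[of _ K] allI impI)
        fix i j assume ij: "i \<ge> K" "j \<ge> K"
        obtain k where "cmod (f (p i) - f (p k)) < e / 2" "cmod (f (p j) - f (p k)) < e / 2"
          using eventually_happens[OF eventually_conj[OF ev[OF ij(1)] ev[OF ij(2)]]] by auto
        then show "dist (f (p i)) (f (p j)) < e"
          by (metis dist_norm dist_triangle_half_l)
      qed
    qed
    then obtain l where l: "(\<lambda>n. f (p n)) \<longlonglongrightarrow> l" using Cauchy_convergent convergent_def by blast
    have "(f \<longlongrightarrow> l) (nontangential x)"
      unfolding tendsto_nontangential_iff
    proof (intro allI impI tendstoI)
      fix a e :: real assume a: "a > 0" and e: "e > 0"
      obtain r where r: "r > 0" "\<And>z. \<bar>Re z - x\<bar> < a * Im z \<Longrightarrow> dist z (of_real x) < r \<Longrightarrow>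
         (\<forall>\<^sub>F k in sequentially. cmod (f z - f (p k)) < e / 2)" using osc[of "e / 2" a] a e by auto
      have "dist (f z) l < e" if z: "\<bar>Re z - x\<bar> < a * Im z" "dist z (of_real x) < r" for z
      proof -
        have "\<forall>\<^sub>F k in sequentially. dist (f (p k)) l < e / 2" using l e by (intro tendstoD) auto
        then obtain k where "cmod (f z - f (p k)) < e / 2" "dist (f (p k)) l < e / 2"
          using eventually_happens[OF eventually_conj[OF r(2)[OF z]]] by fastforce
        then show ?thesis by (metis dist_commute dist_norm dist_triangle_half_l)
      qed
      then show "\<forall>\<^sub>F z in at (of_real x) within {z. \<bar>Re z - x\<bar> < a * Im z}. dist (f z) l < e"
        unfolding eventually_at using r(1) by auto
    qed
    then show ?case by blast
  qed
qed

text \<open>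
  Fatou's lemma, stated for almost everywhere convergence because the boundary function is only
  constructed pointwise.
\<close>

lemma L2_limit:
  fixes G :: "real \<Rightarrow> complex"
  assumes u: "\<And>n. u n \<in> L2" and [measurable]: "G \<in> borel_measurable borel"
    and lim: "AE x in lborel. (\<lambda>n. u n x) \<longlonglongrightarrow> G x"
    and e: "\<forall>\<^sub>F n in sequentially. sqnorm (u n) \<le> e"
  shows "G \<in> L2" "sqnorm G \<le> e"
proof -
  have e0: "e \<ge> 0"
    using eventually_happens[OF e] sqnorm_nonneg order_trans by auto
  have [measurable]: "u n \<in> borel_measurable borel" for n using u by (rule L2_measurable)
  have "(\<integral>\<^sup>+x. ennreal ((cmod (G x))\<^sup>2) \<partial>lborel) = (\<integral>\<^sup>+x. liminf (\<lambda>n. ennreal ((cmod (u n x))\<^sup>2)) \<partial>lborel)"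
  proof (rule nn_integral_cong_AE)
    show "AE x in lborel. ennreal ((cmod (G x))\<^sup>2) = liminf (\<lambda>n. ennreal ((cmod (u n x))\<^sup>2))"
      using lim
    proof eventually_elim
      case (elim x)
      then have "(\<lambda>n. ennreal ((cmod (u n x))\<^sup>2)) \<longlonglongrightarrow> ennreal ((cmod (G x))\<^sup>2)"
        by (intro tendsto_ennrealI tendsto_power tendsto_norm)
      then show ?case by (intro lim_imp_Liminf[symmetric]) auto
    qed
  qed
  also have "\<dots> \<le> liminf (\<lambda>n. \<integral>\<^sup>+x. ennreal ((cmod (u n x))\<^sup>2) \<partial>lborel)"
    by (rule nn_integral_liminf) simp
  also have "\<dots> \<le> limsup (\<lambda>n. \<integral>\<^sup>+x. ennreal ((cmod (u n x))\<^sup>2) \<partial>lborel)"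
    by (rule Liminf_le_Limsup) simp
  also have "\<dots> \<le> ennreal e"
    using e by (intro Limsup_bounded) (auto simp: nn_integral_eq_sqnorm[OF u] elim!: eventually_mono intro: ennreal_leI)
  finally show "G \<in> L2" "sqnorm G \<le> e" using L2I[OF _ _ e0, of G] by auto
qed

text \<open>
  The pointwise limit is also the limit in \<open>L2\<close>, by Fatou's lemma applied to the differences of slices; and
  Poisson integrals at a fixed point are continuous on \<open>L2\<close>. The last clause says that the norm defined by
  boundary values is dominated by the one defined by horizontal lines.
\<close>

lemma hardy2_boundary_function:
  fixes f :: "complex \<Rightarrow> complex"
  assumes f: "f \<in> hardy2"
  obtains G :: "real \<Rightarrow> complex" where "G \<in> L2" "AE x in lborel. (f \<longlongrightarrow> G x) (nontangential x)"
    "\<And>z. Im z > 0 \<Longrightarrow> f z = (LINT t|lborel. poisson z t * G t)"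
    "\<And>M. (\<And>y. y > 0 \<Longrightarrow> sqnorm (slice f y) \<le> M) \<Longrightarrow> sqnorm G \<le> M"
proof -
  define y where "y n = 1 / real (Suc n)" for n
  have y: "y n > 0" for n by (simp add: y_def)
  have y0: "y \<longlonglongrightarrow> 0" unfolding y_def by real_asymp
  note sL = hardy2_slice_L2[OF f y]
  have [measurable]: "slice f (y n) \<in> borel_measurable borel" for n by (rule L2_measurable[OF sL])
  define G where "G x = lim (\<lambda>n. slice f (y n) x)" for x
  have [measurable]: "G \<in> borel_measurable borel"
    unfolding G_def by (rule borel_measurable_lim_metric) measurable
  have nt: "AE x in lborel. (f \<longlongrightarrow> G x) (nontangential x)"
    using hardy2_nontangential_limit[OF f]
  proof eventually_elim
    case (elim x)
    then obtain l where l: "(f \<longlongrightarrow> l) (nontangential x)" by blast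
    from limI[OF tendsto_nontangential_vertical[OF l]] have "G x = l"
      by (simp add: G_def slice_def y_def)
    then show ?case using l by simp
  qed
  then have lim: "AE x in lborel. (\<lambda>n. slice f (y n) x) \<longlonglongrightarrow> G x"
    unfolding slice_def y_def by eventually_elim (rule tendsto_nontangential_vertical)
  have GM: "G \<in> L2" "sqnorm G \<le> M" if "\<And>y. y > 0 \<Longrightarrow> sqnorm (slice f y) \<le> M" for M
    using L2_limit[OF sL _ lim, of M] that y by auto
  have G: "G \<in> L2" by (rule hardy2_slices[OF f]) (rule GM(1))
  define D where "D n = sqnorm (\<lambda>x. slice f (y n) x - G x)" for n
  have D: "D \<longlonglongrightarrow> 0"
  proof (rule tendstoI)
    fix e :: real assume e: "e > 0"
    obtain d where d: "d > 0" "\<And>y y'. 0 < y \<Longrightarrow> y < d \<Longrightarrow> 0 < y' \<Longrightarrow> y' < d \<Longrightarrow> sqnorm (\<lambda>x. slice f y x - slice f y' x) \<le> e / 2"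
      using hardy2_slices_cauchy[OF f, of "e / 2"] e by auto
    have ev: "\<forall>\<^sub>F n in sequentially. y n < d" using y0 d(1) by (rule order_tendstoD)
    then show "\<forall>\<^sub>F n in sequentially. dist (D n) 0 < e"
    proof eventually_elim
      case (elim n)
      have "D n \<le> e / 2" unfolding D_def
      proof (rule L2_limit(2))
        show "(\<lambda>x. slice f (y n) x - slice f (y k) x) \<in> L2" for k by (intro L2_diff sL)
        show "AE x in lborel. (\<lambda>k. slice f (y n) x - slice f (y k) x) \<longlonglongrightarrow> slice f (y n) x - G x"
          using lim by eventually_elim (intro tendsto_intros)
        show "\<forall>\<^sub>F k in sequentially. sqnorm (\<lambda>x. slice f (y n) x - slice f (y k) x) \<le> e / 2"
          using ev by eventually_elim (intro d(2) y elim; simp)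
      qed simp
      then show ?case using e sqnorm_nonneg[of "\<lambda>x. slice f (y n) x - G x"] by (simp add: D_def)
    qed
  qed
  have P: "f z = (LINT t|lborel. poisson z t * G t)" if z: "Im z > 0" for z
  proof -
    define c where "c = (LINT t|lborel. poisson z t * G t)"
    have le: "(cmod (f (z + \<i> * of_real (y n)) - c))\<^sup>2 \<le> D n / (pi * Im z)" for n
    proof -
      have L: "(\<lambda>x. slice f (y n) x - G x) \<in> L2" by (intro L2_diff sL G)
      have "f (z + \<i> * of_real (y n)) - c = (LINT t|lborel. poisson z t * (slice f (y n) t - G t))"
        unfolding c_def hardy2_poisson_slice[OF f y z, symmetric] right_diff_distrib
        by (intro Bochner_Integration.integral_diff[symmetric] poisson_L2_integrable sL G z)
      then show ?thesis
        using poisson_L2_jensen[OF L z] poisson_L2_integrable(2)[OF L z] by (simp add: D_def)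
    qed
    have "isCont f z"
      using hardy2_holomorphic[OF f] open_upper_half_plane z
      by (intro continuous_on_interior[OF holomorphic_on_imp_continuous_on])
         (auto simp: interior_open upper_half_plane_def)
    moreover have "(\<lambda>n. z + \<i> * of_real (y n)) \<longlonglongrightarrow> z + \<i> * of_real 0"
      by (intro tendsto_intros y0)
    ultimately have "(\<lambda>n. f (z + \<i> * of_real (y n))) \<longlonglongrightarrow> f z"
      using isCont_tendsto_compose by fastforce
    then have "(\<lambda>n. (cmod (f (z + \<i> * of_real (y n)) - c))\<^sup>2) \<longlonglongrightarrow> (cmod (f z - c))\<^sup>2"
      by (intro tendsto_intros)
    moreover have "(\<lambda>n. (cmod (f (z + \<i> * of_real (y n)) - c))\<^sup>2) \<longlonglongrightarrow> 0"
    proof (rule tendsto_sandwich[OF _ _ tendsto_const])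
      show "(\<lambda>n. D n / (pi * Im z)) \<longlonglongrightarrow> 0" using tendsto_divide_zero[OF D] .
    qed (use le in auto)
    ultimately have "(cmod (f z - c))\<^sup>2 = 0" using LIMSEQ_unique by blast
    then show ?thesis by (simp add: c_def)
  qed
  show ?thesis by (rule that[OF G nt P GM(2)])
qed

text \<open>
  Norm and inner product integrate \<open>boundary_value\<close>, which is measurable only through an almost everywhere
  equal Borel function.
\<close>

lemma integral_lebesgue_eq_lborel:
  fixes F g :: "real \<Rightarrow> 'a::euclidean_space"
  assumes [measurable]: "g \<in> borel_measurable borel" and ae: "AE x in lborel. F x = g x"
  shows "(LINT x|lebesgue. F x) = (LINT x|lborel. g x)"
proof -
  have gm: "g \<in> borel_measurable lebesgue" by (rule measurable_completion) simp
  have ae': "AE x in lebesgue. g x = F x"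
    using AE_completion[OF ae] by eventually_elim simp
  have "(LINT x|lebesgue. F x) = (LINT x|lebesgue. g x)"
    using ae' by (intro integral_cong_AE borel_measurable_AE[OF gm ae'] gm) auto
  also have "\<dots> = (LINT x|lborel. g x)" by (rule integral_completion) simp
  finally show ?thesis .
qed

lemma boundary_value_eqI: "(f \<longlongrightarrow> l) (nontangential x) \<Longrightarrow> boundary_value f x = l"
  unfolding boundary_value_def by (rule tendsto_Lim[OF nontangential_neq_bot])

lemma hardy2_norm_eq:
  assumes G: "G \<in> L2" and nt: "AE x in lborel. (f \<longlongrightarrow> G x) (nontangential x)"
  shows "hardy2_norm f = sqrt (sqnorm G)"
proof -
  note [measurable] = L2_measurable[OF G]
  have "(LINT x|lebesgue. (cmod (boundary_value f x))\<^sup>2) = (LINT x|lborel. (cmod (G x))\<^sup>2)"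
    by (rule integral_lebesgue_eq_lborel) (use nt in \<open>auto simp: boundary_value_eqI elim!: eventually_mono\<close>)
  then show ?thesis by (simp add: hardy2_norm_def sqnorm_def)
qed

lemma hardy2_point_evaluation:
  assumes f: "f \<in> hardy2" and z: "Im z > 0"
  shows "(cmod (f z))\<^sup>2 \<le> (hardy2_norm f)\<^sup>2 / (pi * Im z)"
proof -
  obtain G :: "real \<Rightarrow> complex" where G: "G \<in> L2" "AE x in lborel. (f \<longlongrightarrow> G x) (nontangential x)"
    and P: "\<And>z. Im z > 0 \<Longrightarrow> f z = (LINT t|lborel. poisson z t * G t)"
    by (rule hardy2_boundary_function[OF f]) blast
  have "(cmod (f z))\<^sup>2 \<le> sqnorm G / (pi * Im z)"
    using poisson_L2_jensen[OF G(1) z] poisson_L2_integrable(2)[OF G(1) z] P[OF z] by simp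
  then show ?thesis using hardy2_norm_eq[OF G(1,2)] sqnorm_nonneg by simp
qed

section \<open>Boundary values of products and of inner functions\<close>

text \<open>
  Up to a constant the squared Cauchy kernel is the Poisson kernel; this evaluates its \<open>L2\<close> norm.
\<close>

lemma cmod_cauchy_kernel_sq:
  assumes "Im c > 0"
  shows "(cmod (1 / (of_real x - c)))\<^sup>2 = pi / Im c * poisson c x"
  using assms real_neq_upper[OF assms, of x]
  by (simp add: poisson_def norm_divide power_divide)

lemma cmod_real_diff_cnj: "cmod (of_real x - cnj c) = cmod (of_real x - c)"
  by (metis complex_cnj_complex_of_real complex_cnj_diff complex_mod_cnj)

lemma hardy2_bounded_mult:
  fixes h q :: "complex \<Rightarrow> complex"
  assumes h: "h \<in> hardy2" and q: "q holomorphic_on upper_half_plane"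
    and B: "\<And>z. z \<in> upper_half_plane \<Longrightarrow> cmod (q z) \<le> B"
  shows "(\<lambda>z. q z * h z) \<in> hardy2"
proof -
  obtain M where M: "M \<ge> 0" "\<And>y. y > 0 \<Longrightarrow> slice h y \<in> L2" "\<And>y. y > 0 \<Longrightarrow> sqnorm (slice h y) \<le> M"
    using hardy2_slices[OF h] by blast
  have "(\<integral>\<^sup>+x. ennreal ((cmod (slice (\<lambda>z. q z * h z) y x))\<^sup>2) \<partial>lborel) \<le> ennreal (B\<^sup>2 * M)" if y: "y > 0" for y
  proof -
    note [measurable] = L2_measurable[OF M(2)[OF y]]
    have "(\<integral>\<^sup>+x. ennreal ((cmod (slice (\<lambda>z. q z * h z) y x))\<^sup>2) \<partial>lborel)
        \<le> (\<integral>\<^sup>+x. ennreal (B\<^sup>2) * ennreal ((cmod (slice h y x))\<^sup>2) \<partial>lborel)"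
    proof (intro nn_integral_mono)
      fix x
      have "(cmod (q (Complex x y)))\<^sup>2 \<le> B\<^sup>2"
        using B[of "Complex x y"] y by (intro power_mono) (auto simp: upper_half_plane_def)
      then have "(cmod (slice (\<lambda>z. q z * h z) y x))\<^sup>2 \<le> B\<^sup>2 * (cmod (slice h y x))\<^sup>2"
        by (auto simp: slice_def norm_mult power_mult_distrib intro: mult_right_mono)
      then show "ennreal ((cmod (slice (\<lambda>z. q z * h z) y x))\<^sup>2) \<le> ennreal (B\<^sup>2) * ennreal ((cmod (slice h y x))\<^sup>2)"
        by (simp add: ennreal_mult[symmetric] ennreal_leI)
    qed
    also have "\<dots> = ennreal (B\<^sup>2) * ennreal (sqnorm (slice h y))"
      by (simp add: nn_integral_cmult nn_integral_eq_sqnorm[OF M(2)[OF y]])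
    also have "\<dots> \<le> ennreal (B\<^sup>2) * ennreal M" by (intro mult_left_mono ennreal_leI M(3) y) auto
    also have "\<dots> = ennreal (B\<^sup>2 * M)" using M(1) by (intro ennreal_mult[symmetric]) auto
    finally show ?thesis .
  qed
  moreover have "(\<lambda>z. q z * h z) holomorphic_on upper_half_plane"
    by (intro holomorphic_intros q hardy2_holomorphic h)
  ultimately show ?thesis using M(1) by (auto simp: hardy2_iff intro!: exI[of _ "B\<^sup>2 * M"])
qed

lemma integral_poisson_extension:
  fixes G :: "real \<Rightarrow> complex"
  assumes G: "integrable lborel G" and y: "y > 0"
  shows "(LINT x|lborel. (LINT t|lborel. poisson (Complex x y) t * G t)) = (LINT t|lborel. G t)"
proof -
  have [measurable]: "G \<in> borel_measurable borel" using borel_measurable_integrable[OF G] by simp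
  let ?F = "\<lambda>(x, t). poisson (Complex x y) t * G t"
  have int: "integrable (lborel \<Otimes>\<^sub>M lborel) ?F"
  proof (rule integrableI_bounded)
    show "?F \<in> borel_measurable (lborel \<Otimes>\<^sub>M lborel)"
      unfolding poisson_Complex by measurable
    have "(\<integral>\<^sup>+p. ennreal (norm (?F p)) \<partial>(lborel \<Otimes>\<^sub>M lborel))
        = (\<integral>\<^sup>+x. (\<integral>\<^sup>+t. ennreal (norm (?F (x, t))) \<partial>lborel) \<partial>lborel)"
      unfolding poisson_Complex by (subst lborel.nn_integral_fst[symmetric]) measurable
    also have "\<dots> = (\<integral>\<^sup>+x. (\<integral>\<^sup>+t. ennreal (poisson (Complex x y) t) * ennreal (cmod (G t)) \<partial>lborel) \<partial>lborel)"
      using y by (intro nn_integral_cong) (simp add: norm_mult poisson_nonneg ennreal_mult)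
    also have "\<dots> = (\<integral>\<^sup>+t. ennreal (cmod (G t)) \<partial>lborel)"
      using y by (intro nn_integral_poisson_extension) measurable
    also have "\<dots> < \<infinity>" using G by (simp add: integrable_iff_bounded)
    finally show "(\<integral>\<^sup>+p. ennreal (norm (?F p)) \<partial>(lborel \<Otimes>\<^sub>M lborel)) < \<infinity>" .
  qed
  have "(LINT x|lborel. (LINT t|lborel. poisson (Complex x y) t * G t)) = (LINT x|lborel. (LINT t|lborel. ?F (x, t)))"
    by simp
  also have "\<dots> = (LINT t|lborel. (LINT x|lborel. ?F (x, t)))"
    using lborel_pair.Fubini_integral[of "\<lambda>x t. ?F (x, t)"] int by simp
  also have "\<dots> = (LINT t|lborel. G t)"
  proof (intro Bochner_Integration.integral_cong refl)
    fix t
    have "(LINT x|lborel. ?F (x, t)) = (LINT x|lborel. of_real (poisson (Complex t y) x) * G t)"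
      by (simp add: poisson_swap[of _ y t])
    also have "\<dots> = (LINT x|lborel. of_real (poisson (Complex t y) x)) * G t"
      by (rule integral_mult_left_zero)
    also have "\<dots> = G t" using y integral_poisson[of "Complex t y"] by simp
    finally show "(LINT x|lborel. ?F (x, t)) = G t" .
  qed
  finally show ?thesis .
qed

lemma nontangential_le_at: "nontangential x \<le> at (of_real x)"
  unfolding nontangential_def by (intro SUP_least at_le) auto

lemma tendsto_ident_nontangential: "((\<lambda>z. z) \<longlongrightarrow> of_real x) (nontangential x)"
  by (rule tendsto_mono[OF nontangential_le_at]) (rule tendsto_ident_at)

text \<open>
  The Poisson formula on the line at height \<open>1 / (n + 1)\<close>, with dominated convergence as \<open>n\<close> tends to
  infinity.
\<close>

lemma inner_function_boundary:
  fixes chi :: "complex \<Rightarrow> complex"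
  assumes "inner_function chi"
  obtains X :: "real \<Rightarrow> complex" where "X \<in> borel_measurable borel" "AE x in lborel. (chi \<longlongrightarrow> X x) (nontangential x)"
    "AE x in lborel. cmod (X x) = 1"
    "\<And>z. Im z > 0 \<Longrightarrow> chi z = (LINT t|lborel. poisson z t * X t)"
proof -
  have chi: "chi holomorphic_on upper_half_plane" "\<And>z. Im z > 0 \<Longrightarrow> cmod (chi z) \<le> 1"
    and ae: "AE x in lborel. \<exists>l. (chi \<longlongrightarrow> l) (nontangential x) \<and> cmod l = 1"
    using assms by (auto simp: inner_function_def upper_half_plane_def AE_completion_iff)
  define y where "y n = 1 / real (Suc n)" for n
  have y: "y n > 0" for n by (simp add: y_def)
  have y0: "y \<longlonglongrightarrow> 0" unfolding y_def by real_asymp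
  have [measurable]: "slice chi (y n) \<in> borel_measurable borel" for n by (intro slice_measurable chi y)
  define X where "X x = lim (\<lambda>n. slice chi (y n) x)" for x
  have [measurable]: "X \<in> borel_measurable borel"
    unfolding X_def by (rule borel_measurable_lim_metric) measurable
  have nt: "AE x in lborel. (chi \<longlongrightarrow> X x) (nontangential x) \<and> cmod (X x) = 1"
    using ae
  proof eventually_elim
    case (elim x)
    then obtain l where l: "(chi \<longlongrightarrow> l) (nontangential x)" "cmod l = 1" by blast
    from limI[OF tendsto_nontangential_vertical[OF l(1)]] have "X x = l"
      by (simp add: X_def slice_def y_def)
    then show ?case using l by simp
  qed
  have P: "chi z = (LINT t|lborel. poisson z t * X t)" if z: "Im z > 0" for z
  proof -
    note [measurable] = borel_measurable_poisson[OF z]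
    have "(\<lambda>n. LINT t|lborel. poisson z t * slice chi (y n) t) \<longlonglongrightarrow> (LINT t|lborel. poisson z t * X t)"
    proof (rule integral_dominated_convergence[where w="poisson z"])
      show "AE t in lborel. (\<lambda>n. poisson z t * slice chi (y n) t) \<longlonglongrightarrow> poisson z t * X t"
        using nt
      proof eventually_elim
        case (elim t)
        have "(\<lambda>n. slice chi (y n) t) \<longlonglongrightarrow> X t"
          unfolding slice_def y_def using elim by (intro tendsto_nontangential_vertical) simp
        then show ?case by (intro tendsto_intros)
      qed
      show "AE t in lborel. norm (poisson z t * slice chi (y n) t) \<le> poisson z t" for n
        using chi(2)[of "Complex _ (y n)"] y[of n] poisson_nonneg[OF z]
        by (intro AE_I2) (simp add: norm_mult slice_def mult_left_le)
    qed (use integrable_poisson[OF z] in auto)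
    moreover have "(LINT t|lborel. poisson z t * slice chi (y n) t) = chi (z + \<i> * of_real (y n))" for n
      by (rule poisson_formula_slice(2)[OF chi(1) y _ z, where B=1]) (use chi(2) y[of n] in auto)
    moreover have "(\<lambda>n. chi (z + \<i> * of_real (y n))) \<longlonglongrightarrow> chi z"
    proof -
      have "isCont chi z"
        using chi(1) open_upper_half_plane z
        by (intro continuous_on_interior[OF holomorphic_on_imp_continuous_on])
           (auto simp: interior_open upper_half_plane_def)
      moreover have "(\<lambda>n. z + \<i> * of_real (y n)) \<longlonglongrightarrow> z + \<i> * of_real 0"
        by (intro tendsto_intros y0)
      ultimately show ?thesis using isCont_tendsto_compose by fastforce
    qed
    ultimately show ?thesis using LIMSEQ_unique by simp
  qed
  show ?thesis by (rule that[of X]) (use nt P in \<open>auto elim: eventually_mono\<close>)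
qed

section \<open>The kernels of the model space\<close>

text \<open>
  Up to the factor \<open>\<i> / (2 * pi)\<close> this is the reproducing kernel of the model space at \<open>w\<close>. Dropping the
  factor is harmless, since only the ratio of its norm to its value at \<open>w\<close> matters.
\<close>

definition model_kernel :: "(complex \<Rightarrow> complex) \<Rightarrow> complex \<Rightarrow> complex \<Rightarrow> complex" where
  "model_kernel chi w z = (1 - cnj (chi w) * chi z) / (z - cnj w)"

lemma model_kernel_hardy2:
  assumes hol: "chi holomorphic_on upper_half_plane" and le: "\<And>z. Im z > 0 \<Longrightarrow> cmod (chi z) \<le> 1"
    and w: "Im w > 0"
  shows "model_kernel chi w \<in> hardy2"
  unfolding hardy2_iff
proof (intro conjI exI[of _ "4 * pi / Im w"] allI impI)
  show "model_kernel chi w holomorphic_on upper_half_plane"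
    unfolding model_kernel_def using w
    by (intro holomorphic_intros hol) (auto simp: upper_half_plane_def complex_eq_iff)
  fix y :: real assume y: "y > 0"
  define c where "c = w + \<i> * of_real y"
  have c: "Im c > 0" using y w by (simp add: c_def)
  have "(cmod (slice (model_kernel chi w) y x))\<^sup>2 \<le> (4 * pi / Im c) * poisson c x" for x
  proof -
    have e: "Complex x y - cnj w = of_real x - cnj c" by (simp add: c_def complex_eq_iff)
    have "cmod (1 - cnj (chi w) * chi (Complex x y)) \<le> 1 + cmod (chi w) * cmod (chi (Complex x y))"
      using norm_triangle_ineq4[of 1 "cnj (chi w) * chi (Complex x y)"] by (simp add: norm_mult)
    also have "\<dots> \<le> 1 + 1 * 1"
      using le[OF w] le[of "Complex x y"] y by (intro add_left_mono mult_mono) auto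
    finally have "(cmod (1 - cnj (chi w) * chi (Complex x y)))\<^sup>2 \<le> 2\<^sup>2" by (intro power_mono) auto
    then have "(cmod (1 - cnj (chi w) * chi (Complex x y)))\<^sup>2 * (cmod (1 / (of_real x - c)))\<^sup>2
        \<le> 2\<^sup>2 * (cmod (1 / (of_real x - c)))\<^sup>2" by (rule mult_right_mono) simp
    moreover have "cmod (slice (model_kernel chi w) y x) = cmod (1 - cnj (chi w) * chi (Complex x y)) * cmod (1 / (of_real x - c))"
      unfolding slice_def model_kernel_def e by (simp add: norm_divide cmod_real_diff_cnj)
    ultimately show ?thesis
      using cmod_cauchy_kernel_sq[OF c, of x] by (simp add: power_mult_distrib)
  qed
  then have "(\<integral>\<^sup>+x. ennreal ((cmod (slice (model_kernel chi w) y x))\<^sup>2) \<partial>lborel)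
      \<le> (\<integral>\<^sup>+x. ennreal (4 * pi / Im c) * ennreal (poisson c x) \<partial>lborel)"
    using c by (intro nn_integral_mono) (simp add: ennreal_mult[symmetric] poisson_nonneg ennreal_leI)
  also have "\<dots> = ennreal (4 * pi / Im c)"
    using c by (simp add: nn_integral_cmult nn_integral_poisson)
  also have "\<dots> \<le> ennreal (4 * pi / Im w)"
    using y w by (intro ennreal_leI divide_left_mono) (auto simp: c_def)
  finally show "(\<integral>\<^sup>+x. ennreal ((cmod (slice (model_kernel chi w) y x))\<^sup>2) \<partial>lborel) \<le> ennreal (4 * pi / Im w)" .
qed (use w in simp)

text \<open>
  On the real line \<open>cmod chi = 1\<close>, so the squared modulus of the kernel is \<open>pi / Im w\<close> times the Poisson kernel
  times \<open>1 + (cmod (chi w))\<^sup>2 - 2 * Re (cnj (chi w) * chi x)\<close>; the Poisson formula for \<open>chi\<close> at \<open>w\<close>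
  evaluates the integral.
\<close>

lemma model_kernel_norm:
  assumes chi: "inner_function chi" and w: "Im w > 0"
  shows "(hardy2_norm (model_kernel chi w))\<^sup>2 = pi * (1 - (cmod (chi w))\<^sup>2) / Im w"
proof -
  obtain X :: "real \<Rightarrow> complex" where X[measurable]: "X \<in> borel_measurable borel"
    and nt: "AE x in lborel. (chi \<longlongrightarrow> X x) (nontangential x)"
    and u: "AE x in lborel. cmod (X x) = 1"
    and Pz: "\<And>z. Im z > 0 \<Longrightarrow> chi z = (LINT t|lborel. poisson z t * X t)"
    by (rule inner_function_boundary[OF chi]) blast
  note P = Pz[OF w]
  note [measurable] = borel_measurable_poisson[OF w]
  define a where "a = chi w"
  define K where "K x = (1 - cnj a * X x) / (of_real x - cnj w)" for x :: real
  have [measurable]: "K \<in> borel_measurable borel" unfolding K_def by measurable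
  have Knt: "AE x in lborel. (model_kernel chi w \<longlongrightarrow> K x) (nontangential x)"
    using nt
  proof eventually_elim
    case (elim x)
    have "complex_of_real x - cnj w \<noteq> 0" using w by (auto simp: complex_eq_iff)
    then show ?case
      unfolding K_def model_kernel_def a_def
      by (intro tendsto_intros elim tendsto_ident_nontangential)
  qed
  have PX: "integrable lborel (\<lambda>t. poisson w t * X t)"
    by (rule Bochner_Integration.integrable_bound[OF integrable_poisson[OF w]])
       (use u in \<open>auto simp: norm_mult elim!: eventually_mono\<close>)
  define R where "R x = pi / Im w * ((1 + (cmod a)\<^sup>2) * poisson w x - 2 * Re (cnj a * (poisson w x * X x)))" for x
  have ae: "AE x in lborel. R x = (cmod (K x))\<^sup>2"
    using u
  proof eventually_elim
    case (elim x)
    have "(cmod (K x))\<^sup>2 = (cmod (1 - cnj a * X x))\<^sup>2 * (cmod (1 / (of_real x - w)))\<^sup>2"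
      by (simp add: K_def norm_divide cmod_real_diff_cnj power_divide)
    also have "(cmod (1 / (of_real x - w)))\<^sup>2 = pi / Im w * poisson w x"
      by (rule cmod_cauchy_kernel_sq[OF w])
    also have "(cmod (1 - cnj a * X x))\<^sup>2 = 1 + (cmod (cnj a * X x))\<^sup>2 - 2 * Re (cnj a * X x)"
      unfolding cmod_power2 by (simp add: power2_eq_square algebra_simps)
    also have "cmod (cnj a * X x) = cmod a" using elim by (simp add: norm_mult)
    finally show ?case by (simp add: R_def algebra_simps add_divide_distrib)
  qed
  have R: "has_bochner_integral lborel R (pi * (1 - (cmod a)\<^sup>2) / Im w)"
  proof -
    have "has_bochner_integral lborel (\<lambda>x. cnj a * (poisson w x * X x)) (cnj a * a)"
      using PX P by (simp add: has_bochner_integral_iff a_def)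
    then have 1: "has_bochner_integral lborel (\<lambda>x. Re (cnj a * (poisson w x * X x))) (Re (cnj a * a))"
      by (rule has_bochner_integral_Re)
    have lin: "has_bochner_integral lborel (\<lambda>x. k * (c * u x - 2 * v x)) (k * (c * I - 2 * J))"
      if "has_bochner_integral lborel u I" "has_bochner_integral lborel v J" for u v :: "real \<Rightarrow> real" and k c I J
      using that by (simp add: has_bochner_integral_iff)
    have "has_bochner_integral lborel R (pi / Im w * ((1 + (cmod a)\<^sup>2) * 1 - 2 * Re (cnj a * a)))"
      unfolding R_def by (rule lin[OF has_bochner_integral_poisson[OF w] 1])
    also have "Re (cnj a * a) = (cmod a)\<^sup>2"
      unfolding cmod_power2 by (simp add: power2_eq_square)
    finally show ?thesis by (simp add: algebra_simps add_divide_distrib diff_divide_distrib)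
  qed
  have Rm[measurable]: "R \<in> borel_measurable borel" unfolding R_def by measurable
  have "integrable lborel (\<lambda>x. (cmod (K x))\<^sup>2)"
    using R by (intro integrable_cong_AE_imp[OF _ _ ae]) (auto simp: has_bochner_integral_iff)
  then have KL: "K \<in> L2" by (simp add: L2_def)
  have "sqnorm K = integral\<^sup>L lborel R"
    unfolding sqnorm_def using ae by (intro integral_cong_AE) (auto elim: eventually_mono)
  also have "\<dots> = pi * (1 - (cmod a)\<^sup>2) / Im w" using R by (simp add: has_bochner_integral_iff)
  finally show ?thesis
    using hardy2_norm_eq[OF KL Knt] sqnorm_nonneg[of K] by (simp add: a_def)
qed

text \<open>
  Near \<open>w\<close> this is compactness, away from \<open>w\<close> the denominator is bounded below.
\<close>

lemma difference_quotient_bounded: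
  assumes hol: "chi holomorphic_on upper_half_plane" and le: "\<And>z. Im z > 0 \<Longrightarrow> cmod (chi z) \<le> 1"
    and w: "Im w > 0"
  defines "q \<equiv> \<lambda>z. if z = w then deriv chi w else (chi z - chi w) / (z - w)"
  obtains B where "q holomorphic_on upper_half_plane" "\<And>z. z \<in> upper_half_plane \<Longrightarrow> cmod (q z) \<le> B"
proof -
  have q: "q holomorphic_on upper_half_plane"
    unfolding q_def by (rule pole_lemma_open[OF hol open_upper_half_plane])
  define r where "r = Im w / 2"
  have r: "r > 0" using w by (simp add: r_def)
  have sub: "cball w r \<subseteq> upper_half_plane"
  proof
    fix z assume "z \<in> cball w r"
    then show "z \<in> upper_half_plane"
      using abs_Im_le_cmod[of "w - z"] w by (simp add: dist_norm upper_half_plane_def r_def)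
  qed
  have "compact (q ` cball w r)"
    using holomorphic_on_imp_continuous_on[OF holomorphic_on_subset[OF q sub]]
    by (intro compact_continuous_image) auto
  then have "bounded (q ` cball w r)" by (rule compact_imp_bounded)
  then obtain C where "\<forall>z\<in>cball w r. cmod (q z) \<le> C"
    by (auto simp: bounded_iff)
  then have C: "\<And>z. z \<in> cball w r \<Longrightarrow> cmod (q z) \<le> C" by blast
  have "cmod (q z) \<le> max C (2 / r)" if z: "z \<in> upper_half_plane" for z
  proof (cases "z \<in> cball w r")
    case True
    then show ?thesis using C by (simp add: le_max_iff_disj)
  next
    case False
    then have d: "cmod (z - w) > r" by (simp add: dist_norm norm_minus_commute)
    have "cmod (chi z - chi w) \<le> 2"
      using norm_triangle_ineq4[of "chi z" "chi w"] le[OF w] le[of z] z by (simp add: upper_half_plane_def)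
    then have "cmod (chi z - chi w) / cmod (z - w) \<le> 2 / r" using d r by (intro frac_le) auto
    moreover have "z \<noteq> w" using d r by auto
    ultimately show ?thesis by (simp add: q_def norm_divide le_max_iff_disj)
  qed
  then show ?thesis using q that by blast
qed

text \<open>
  Since \<open>chi * cnj chi = 1\<close> on the real line, the inner product is the conjugate of the integral of the
  boundary values of \<open>g z = (chi z - chi w) / (z - w) * h z\<close>, a Hardy function whose boundary values are
  integrable. Being a Poisson integral, \<open>g\<close> has the same integral over every horizontal line, and that
  integral tends to zero as the line moves up.
\<close>

lemma model_kernel_orthogonal:
  assumes chi: "inner_function chi" and w: "Im w > 0" and h: "h \<in> hardy2"
  shows "hardy2_inner (model_kernel chi w) (\<lambda>z. chi z * h z) = 0"
proof -
  have hol: "chi holomorphic_on upper_half_plane" and le: "\<And>z. Im z > 0 \<Longrightarrow> cmod (chi z) \<le> 1"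
    using chi by (auto simp: inner_function_def upper_half_plane_def)
  obtain X :: "real \<Rightarrow> complex" where X[measurable]: "X \<in> borel_measurable borel"
    and Xnt: "AE x in lborel. (chi \<longlongrightarrow> X x) (nontangential x)"
    and X1: "AE x in lborel. cmod (X x) = 1"
    by (rule inner_function_boundary[OF chi]) blast
  obtain H :: "real \<Rightarrow> complex" where H: "H \<in> L2" and Hnt: "AE x in lborel. (h \<longlongrightarrow> H x) (nontangential x)"
    by (rule hardy2_boundary_function[OF h]) blast
  obtain M where M: "M \<ge> 0" "\<And>y. y > 0 \<Longrightarrow> slice h y \<in> L2" "\<And>y. y > 0 \<Longrightarrow> sqnorm (slice h y) \<le> M"
    by (rule hardy2_slices[OF h]) blast
  note [measurable] = L2_measurable[OF H] borel_measurable_poisson[OF w]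
  define a where "a = chi w"
  define q where "q = (\<lambda>z. if z = w then deriv chi w else (chi z - chi w) / (z - w))"
  define g where "g = (\<lambda>z. q z * h z)"
  have g: "g \<in> hardy2"
  proof -
    obtain B where "q holomorphic_on upper_half_plane" "\<And>z. z \<in> upper_half_plane \<Longrightarrow> cmod (q z) \<le> B"
      unfolding q_def by (rule difference_quotient_bounded[OF hol le w]) blast+
    then show ?thesis unfolding g_def by (rule hardy2_bounded_mult[OF h])
  qed
  obtain G :: "real \<Rightarrow> complex" where G: "G \<in> L2" and Gnt: "AE x in lborel. (g \<longlongrightarrow> G x) (nontangential x)"
    and GP: "\<And>z. Im z > 0 \<Longrightarrow> g z = (LINT t|lborel. poisson z t * G t)"
    by (rule hardy2_boundary_function[OF g]) blast
  note [measurable] = L2_measurable[OF G]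
  define Q where "Q x = (X x - a) / (of_real x - w)" for x :: real
  have [measurable]: "Q \<in> borel_measurable borel" unfolding Q_def by measurable
  have GQ: "AE x in lborel. G x = Q x * H x"
    using Gnt Xnt Hnt
  proof eventually_elim
    case (elim x)
    have ne: "complex_of_real x \<noteq> w" using w by auto
    have "((\<lambda>z. (chi z - a) / (z - w) * h z) \<longlongrightarrow> Q x * H x) (nontangential x)"
      unfolding Q_def using ne by (intro tendsto_intros elim tendsto_ident_nontangential) auto
    moreover have "\<forall>\<^sub>F z in nontangential x. (chi z - a) / (z - w) * h z = g z"
      using tendsto_imp_eventually_ne[OF tendsto_ident_nontangential ne]
      by eventually_elim (simp add: g_def q_def a_def)
    ultimately have "(g \<longlongrightarrow> Q x * H x) (nontangential x)"
      by (rule Lim_transform_eventually)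
    then show ?case
      using tendsto_unique[OF nontangential_neq_bot elim(1)] by blast
  qed
  have QL: "Q \<in> L2"
  proof -
    have "integrable lborel (\<lambda>x. (cmod (Q x))\<^sup>2)"
    proof (rule Bochner_Integration.integrable_bound[where f="\<lambda>x. (4 * pi / Im w) * poisson w x"])
      show "AE x in lborel. norm ((cmod (Q x))\<^sup>2) \<le> norm ((4 * pi / Im w) * poisson w x)"
        using X1
      proof eventually_elim
        case (elim x)
        have "cmod (X x - a) \<le> 2"
          using norm_triangle_ineq4[of "X x" a] le[OF w] elim by (simp add: a_def)
        then have "(cmod (X x - a))\<^sup>2 * (cmod (1 / (of_real x - w)))\<^sup>2 \<le> 2\<^sup>2 * (cmod (1 / (of_real x - w)))\<^sup>2"
          by (intro mult_right_mono power_mono) auto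
        moreover have "(cmod (Q x))\<^sup>2 = (cmod (X x - a))\<^sup>2 * (cmod (1 / (of_real x - w)))\<^sup>2"
          by (simp add: Q_def norm_divide power_divide)
        ultimately have "(cmod (Q x))\<^sup>2 \<le> 2\<^sup>2 * (pi / Im w * poisson w x)"
          unfolding cmod_cauchy_kernel_sq[OF w] by linarith
        then show ?case using poisson_nonneg[OF w, of x] w by simp
      qed
    qed (use integrable_poisson[OF w] in auto)
    then show ?thesis by (simp add: L2_def)
  qed
  have Gint: "integrable lborel G"
  proof (rule integrable_cong_AE_imp[OF L2_mult_integrable[OF QL H]])
    show "AE x in lborel. Q x * H x = G x" using GQ by eventually_elim simp
  qed simp
  have small: "cmod (LINT x|lborel. G x) \<le> (pi + M) / r" if r: "r > 0" for r
  proof -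
    \<comment> \<open>At this height \<open>1 / (z - w)\<close> has squared norm \<open>pi / r\<^sup>2\<close>; the weighted inequality of the means below then
      gives a bound of order \<open>1 / r\<close>.\<close>
    define y where "y = Im w + r\<^sup>2"
    have y: "y > 0" using w r by (simp add: y_def add_pos_nonneg)
    define c where "c = cnj (w - \<i> * of_real y)"
    have c: "Im c = r\<^sup>2" by (simp add: c_def y_def)
    then have c0: "Im c > 0" using r by simp
    have "(LINT x|lborel. G x) = (LINT x|lborel. slice g y x)"
      using integral_poisson_extension[OF Gint y] GP y by (simp add: slice_def)
    also have "cmod \<dots> \<le> (LINT x|lborel. cmod (slice g y x))" by (rule integral_norm_bound)
    also have "\<dots> \<le> (LINT x|lborel. pi / r * poisson c x + (cmod (slice h y x))\<^sup>2 / r)"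
    proof (rule integral_mono')
      show "integrable lborel (\<lambda>x. pi / r * poisson c x + (cmod (slice h y x))\<^sup>2 / r)"
        using integrable_poisson[OF c0] L2_integrable[OF M(2)[OF y]] by auto
      fix x
      have ne: "Complex x y \<noteq> w" using r by (auto simp: complex_eq_iff y_def)
      have e: "Complex x y - w = of_real x - cnj c" by (simp add: c_def complex_eq_iff)
      define A where "A = cmod (1 / (of_real x - c))"
      define B where "B = cmod (slice h y x)"
      have "cmod (chi (Complex x y) - chi w) \<le> 2"
        using norm_triangle_ineq4[of "chi (Complex x y)" "chi w"] le[OF w] le[of "Complex x y"] y by simp
      then have "cmod (chi (Complex x y) - chi w) * A * B \<le> 2 * A * B"
        by (intro mult_right_mono) (auto simp: A_def B_def)
      moreover have "cmod (slice g y x) = cmod (chi (Complex x y) - chi w) * A * B"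
        using ne unfolding slice_def g_def q_def A_def B_def
        by (simp add: norm_mult norm_divide e cmod_real_diff_cnj)
      ultimately have "cmod (slice g y x) \<le> 2 * A * B" by simp
      also have "2 * A * B \<le> r * A\<^sup>2 + B\<^sup>2 / r"
      proof -
        have "0 \<le> (r * A - B)\<^sup>2 / r" using r by simp
        also have "\<dots> = r * A\<^sup>2 + B\<^sup>2 / r - 2 * A * B"
          using r by (simp add: power2_eq_square field_simps)
        finally show ?thesis by simp
      qed
      also have "r * A\<^sup>2 = pi / r * poisson c x"
        unfolding A_def cmod_cauchy_kernel_sq[OF c0] c using r by (simp add: power2_eq_square)
      finally show "cmod (slice g y x) \<le> pi / r * poisson c x + (cmod (slice h y x))\<^sup>2 / r"
        by (simp add: B_def)
    qed (use r c0 in \<open>auto intro!: add_nonneg_nonneg divide_nonneg_nonneg mult_nonneg_nonneg poisson_nonneg\<close>)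
    also have "\<dots> = pi / r + sqnorm (slice h y) / r"
      using integrable_poisson[OF c0] L2_integrable[OF M(2)[OF y]] integral_poisson[OF c0]
      by (simp add: sqnorm_def)
    also have "\<dots> \<le> (pi + M) / r"
      using M(3)[OF y] r by (simp add: add_divide_distrib divide_right_mono)
    finally show ?thesis .
  qed
  have "(\<lambda>n. (pi + M) / real (Suc n)) \<longlonglongrightarrow> 0"
    using tendsto_mult_right_zero[OF LIMSEQ_inverse_real_of_nat, of "pi + M"] by (simp add: field_simps)
  then have "cmod (LINT x|lborel. G x) \<le> 0"
    by (rule LIMSEQ_le_const) (use small in auto)
  then have G0: "(LINT x|lborel. G x) = 0" by simp
  have "hardy2_inner (model_kernel chi w) (\<lambda>z. chi z * h z) = (LINT x|lborel. cnj (G x))"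
    unfolding hardy2_inner_def
  proof (rule integral_lebesgue_eq_lborel)
    show "(\<lambda>x. cnj (G x)) \<in> borel_measurable borel" using L2_cnj[OF G] by (rule L2_measurable)
    show "AE x in lborel. boundary_value (model_kernel chi w) x * cnj (boundary_value (\<lambda>z. chi z * h z) x) = cnj (G x)"
      using Xnt Hnt X1 GQ
    proof eventually_elim
      case (elim x)
      have ne: "complex_of_real x - cnj w \<noteq> 0" "complex_of_real x - w \<noteq> 0" using w by (auto simp: complex_eq_iff)
      have "boundary_value (model_kernel chi w) x = (1 - cnj a * X x) / (of_real x - cnj w)"
        unfolding model_kernel_def a_def using ne
        by (intro boundary_value_eqI tendsto_intros elim tendsto_ident_nontangential)
      moreover have "boundary_value (\<lambda>z. chi z * h z) x = X x * H x"
        by (intro boundary_value_eqI tendsto_intros elim)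
      moreover have "(1 - cnj a * X x) * cnj (X x) = cnj (X x - a)"
      proof -
        have "X x * cnj (X x) = 1"
          using elim(3) by (simp add: complex_norm_square[symmetric])
        then show ?thesis by (simp add: left_diff_distrib mult.assoc)
      qed
      ultimately have "boundary_value (model_kernel chi w) x * cnj (boundary_value (\<lambda>z. chi z * h z) x)
          = cnj (X x - a) / (of_real x - cnj w) * cnj (H x)"
        by (simp add: mult.assoc[symmetric])
      then show ?case using elim(4) by (simp add: Q_def)
    qed
  qed
  also have "\<dots> = cnj (LINT x|lborel. G x)" by (rule Bochner_Integration.integral_cnj)
  finally show ?thesis using G0 by simp
qed

lemma model_kernel_in_model_space:
  assumes "inner_function chi" "Im w > 0"
  shows "model_kernel chi w \<in> model_space chi"
  using assms model_kernel_orthogonal[OF assms]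
  by (auto simp: model_space_def inner_function_def upper_half_plane_def intro!: model_kernel_hardy2)

section \<open>Composition operators\<close>

text \<open>
  Test the operator on the kernel at \<open>w = \<phi> z\<close>. With \<open>D = 1 - (cmod (chi w))\<^sup>2\<close>, the squared modulus of its
  value at \<open>w\<close> is \<open>D\<^sup>2 / (4 * (Im w)\<^sup>2)\<close> and its squared norm is \<open>pi * D / Im w\<close>; point evaluation of the
  composition at \<open>z\<close> compares the two.
\<close>

lemma bounded_composition_imp_kernel_ratio_bounded:
  fixes chi \<phi> :: "complex \<Rightarrow> complex"
  assumes chi: "inner_function chi" and \<phi>: "\<phi> ` upper_half_plane \<subseteq> upper_half_plane"
    and bc: "bounded_composition chi \<phi>"
  shows "bdd_above ((\<lambda>z. Im z / Im (\<phi> z) * (1 - (cmod (chi (\<phi> z)))\<^sup>2)) ` upper_half_plane)"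
proof -
  obtain M where comp: "\<And>f. f \<in> model_space chi \<Longrightarrow> f \<circ> \<phi> \<in> hardy2"
    and M: "\<And>f. f \<in> model_space chi \<Longrightarrow> hardy2_norm (f \<circ> \<phi>) \<le> M * hardy2_norm f"
    using bc by (auto simp: bounded_composition_def)
  have "Im z / Im (\<phi> z) * (1 - (cmod (chi (\<phi> z)))\<^sup>2) \<le> 4 * M\<^sup>2" if z: "z \<in> upper_half_plane" for z
  proof -
    define w where "w = \<phi> z"
    define D where "D = 1 - (cmod (chi w))\<^sup>2"
    have y: "Im z > 0" and w: "Im w > 0" using z \<phi> by (auto simp: upper_half_plane_def w_def)
    have D: "D \<ge> 0"
      using chi w by (auto simp: D_def inner_function_def upper_half_plane_def intro: power_le_one)
    let ?k = "model_kernel chi w"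
    have k: "?k \<in> model_space chi" by (rule model_kernel_in_model_space[OF chi w])
    have "complex_of_real D = 1 - cnj (chi w) * chi w"
      unfolding D_def of_real_diff complex_norm_square by simp
    then have "?k w = of_real D / (2 * \<i> * of_real (Im w))"
      by (simp add: model_kernel_def complex_diff_cnj mult.commute mult.left_commute)
    then have "(cmod (?k w))\<^sup>2 = D\<^sup>2 / (4 * (Im w)\<^sup>2)"
      by (simp add: norm_divide norm_mult power_divide power_mult_distrib)
    moreover have "(cmod ((?k \<circ> \<phi>) z))\<^sup>2 \<le> (hardy2_norm (?k \<circ> \<phi>))\<^sup>2 / (pi * Im z)"
      by (rule hardy2_point_evaluation[OF comp[OF k] y])
    moreover have "(hardy2_norm (?k \<circ> \<phi>))\<^sup>2 \<le> (M * hardy2_norm ?k)\<^sup>2"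
      using M[OF k] by (intro power_mono) (auto simp: hardy2_norm_def)
    then have "(hardy2_norm (?k \<circ> \<phi>))\<^sup>2 / (pi * Im z) \<le> (M * hardy2_norm ?k)\<^sup>2 / (pi * Im z)"
      using y by (intro divide_right_mono) auto
    moreover have "(M * hardy2_norm ?k)\<^sup>2 / (pi * Im z) = M\<^sup>2 * D / (Im w * Im z)"
      using model_kernel_norm[OF chi w] by (simp add: power_mult_distrib D_def)
    ultimately have "D\<^sup>2 / (4 * (Im w)\<^sup>2) \<le> M\<^sup>2 * D / (Im w * Im z)" by (simp add: w_def)
    then have "D * (Im z * D) \<le> D * (4 * M\<^sup>2 * Im w)"
      using y w by (simp add: field_simps power2_eq_square)
    then have "D = 0 \<or> Im z * D \<le> 4 * M\<^sup>2 * Im w"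
      using D by (auto simp: mult_le_cancel_left)
    then have "Im z / Im w * D \<le> 4 * M\<^sup>2" using w by (auto simp: field_simps)
    then show ?thesis by (simp add: w_def D_def)
  qed
  then show ?thesis by (intro bdd_aboveI2)
qed

text \<open>
  The integrand is \<open>1 / pi\<close> times the imaginary part of \<open>F z = 1 / (t - \<phi> z)\<close>, and \<open>cmod (F z) \<le> C / Im z\<close>.
  The Poisson formula at the point at height \<open>Y\<close> above the line, multiplied by \<open>Y\<close>, bounds the integral
  with the weight \<open>Y\<^sup>2 / (x\<^sup>2 + Y\<^sup>2)\<close> by \<open>C\<close>; the weight tends to one as \<open>Y\<close> grows.
\<close>

lemma nn_integral_poisson_composed:
  assumes hol: "\<phi> holomorphic_on upper_half_plane" and \<phi>: "\<And>z. Im z > 0 \<Longrightarrow> Im (\<phi> z) > 0"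
    and C: "\<And>z. Im z > 0 \<Longrightarrow> Im z \<le> C * Im (\<phi> z)" and y: "y > 0"
  shows "(\<integral>\<^sup>+x. ennreal (poisson (\<phi> (Complex x y)) t) \<partial>lborel) \<le> ennreal C"
proof -
  define F where "F z = 1 / (of_real t - \<phi> z)" for z
  define p where "p x = poisson (\<phi> (Complex x y)) t" for x
  have p0: "p x \<ge> 0" for x unfolding p_def using y by (intro poisson_nonneg \<phi>) simp
  have pF: "p x = Im (slice F y x) / pi" for x
    by (simp add: p_def poisson_as_Im F_def slice_def)
  \<comment> \<open>The hypothesis at the single point \<open>\<i>\<close> forces \<open>C > 0\<close>.\<close>
  have "C * Im (\<phi> \<i>) > 0" using C[of \<i>] by simp
  then have C0: "C > 0" using \<phi>[of \<i>] by (simp add: zero_less_mult_iff)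
  have nz: "of_real t - \<phi> z \<noteq> 0" if "Im z > 0" for z using real_neq_upper[OF \<phi>[OF that]] .
  have F: "F holomorphic_on upper_half_plane"
    unfolding F_def by (intro holomorphic_intros hol) (use nz in \<open>auto simp: upper_half_plane_def\<close>)
  note [measurable] = slice_measurable[OF F y]
  have pm[measurable]: "p \<in> borel_measurable borel" unfolding pF by measurable
  have inv: "1 / Im (\<phi> z) \<le> C / Im z" if "Im z > 0" for z
    using C[OF that] \<phi>[OF that] that by (simp add: field_simps)
  have B: "cmod (F z) \<le> C / y" if "Im z \<ge> y" for z
  proof -
    have z: "Im z > 0" using that y by simp
    have "Im (\<phi> z) \<le> cmod (of_real t - \<phi> z)"
      using abs_Im_le_cmod[of "of_real t - \<phi> z"] by simp
    then have "cmod (F z) \<le> 1 / Im (\<phi> z)"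
      using \<phi>[OF z] by (auto simp: F_def norm_divide intro!: divide_left_mono mult_pos_pos)
    also have "\<dots> \<le> C / Im z" by (rule inv[OF z])
    also have "\<dots> \<le> C / y" using that y C0 by (intro divide_left_mono) auto
    finally show ?thesis .
  qed
  define Y where "Y n = real (Suc n)" for n
  define u where "u n x = (Y n)\<^sup>2 / (x\<^sup>2 + (Y n)\<^sup>2) * p x" for n x
  have Y: "Y n > 0" for n by (simp add: Y_def)
  have le: "(\<integral>\<^sup>+x. ennreal (u n x) \<partial>lborel) \<le> ennreal C" for n
  proof -
    define z where "z = \<i> * of_real (Y n)"
    have z: "Im z > 0" using Y by (simp add: z_def)
    have zy: "Im (z + \<i> * of_real y) > 0" using z y by simp
    note P = poisson_formula_slice[OF F y B z]
    have "has_bochner_integral lborel (\<lambda>x. Im (of_real (poisson z x) * slice F y x)) (Im (F (z + \<i> * of_real y)))"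
      using has_bochner_integral_Im[of lborel "\<lambda>x. of_real (poisson z x) * slice F y x" "F (z + \<i> * of_real y)"] P
      by (simp add: has_bochner_integral_iff)
    from has_bochner_integral_mult_right[OF this, of "Y n"]
    have "has_bochner_integral lborel (\<lambda>x. Y n * Im (of_real (poisson z x) * slice F y x)) (Y n * Im (F (z + \<i> * of_real y)))"
      by blast
    moreover have "Y n * Im (of_real (poisson z x) * slice F y x) = u n x" for x
    proof -
      have "poisson z x = Y n / (pi * (x\<^sup>2 + (Y n)\<^sup>2))"
        unfolding poisson_def cmod_real_diff_sq by (simp add: z_def)
      then show ?thesis by (simp add: pF u_def power2_eq_square mult.commute[of pi] mult.assoc)
    qed
    ultimately have "has_bochner_integral lborel (u n) (Y n * Im (F (z + \<i> * of_real y)))" by simp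
    moreover have "u n x \<ge> 0" for x using p0 by (simp add: u_def)
    ultimately have "(\<integral>\<^sup>+x. ennreal (u n x) \<partial>lborel) = ennreal (Y n * Im (F (z + \<i> * of_real y)))"
      by (simp add: nn_integral_eq_integral has_bochner_integral_iff)
    also have "\<dots> \<le> ennreal C"
    proof (rule ennreal_leI)
      have "Im (F (z + \<i> * of_real y)) / pi \<le> 1 / (pi * Im (\<phi> (z + \<i> * of_real y)))"
        unfolding F_def poisson_as_Im[symmetric] by (rule poisson_le[OF \<phi>[OF zy]])
      then have "Im (F (z + \<i> * of_real y)) \<le> 1 / Im (\<phi> (z + \<i> * of_real y))"
        by (simp add: field_simps)
      also have "\<dots> \<le> C / Im (z + \<i> * of_real y)" by (rule inv[OF zy])
      also have "\<dots> \<le> C / Y n" using C0 Y[of n] y by (intro divide_left_mono) (auto simp: z_def)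
      finally show "Y n * Im (F (z + \<i> * of_real y)) \<le> C" using Y[of n] by (simp add: field_simps)
    qed
    finally show ?thesis .
  qed
  have lim: "(\<lambda>n. ennreal (u n x)) \<longlonglongrightarrow> ennreal (p x)" for x
  proof -
    have "(\<lambda>n. (Y n)\<^sup>2 / (x\<^sup>2 + (Y n)\<^sup>2)) \<longlonglongrightarrow> 1" unfolding Y_def by real_asymp
    from tendsto_mult[OF this tendsto_const, of "p x"] show ?thesis
      unfolding u_def by (intro tendsto_ennrealI) simp
  qed
  have um: "u n \<in> borel_measurable borel" for n unfolding u_def by measurable
  have "(\<integral>\<^sup>+x. ennreal (p x) \<partial>lborel) = (\<integral>\<^sup>+x. liminf (\<lambda>n. ennreal (u n x)) \<partial>lborel)"
    by (intro nn_integral_cong lim_imp_Liminf[symmetric] lim) simp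
  also have "\<dots> \<le> liminf (\<lambda>n. \<integral>\<^sup>+x. ennreal (u n x) \<partial>lborel)"
    using um by (intro nn_integral_liminf) simp
  also have "\<dots> \<le> limsup (\<lambda>n. \<integral>\<^sup>+x. ennreal (u n x) \<partial>lborel)"
    by (rule Liminf_le_Limsup) simp
  also have "\<dots> \<le> ennreal C"
    by (intro Limsup_bounded always_eventually allI le)
  finally show ?thesis by (simp add: p_def)
qed

text \<open>
  By Jensen's inequality \<open>(cmod (f w))\<^sup>2\<close> is at most the Poisson integral at \<open>w\<close> of the squared boundary
  values. Put \<open>w = \<phi> (x + \<i> * y)\<close>, integrate over \<open>x\<close> first and use the previous lemma.
\<close>

lemma hardy2_composition:
  assumes hol: "\<phi> holomorphic_on upper_half_plane" and \<phi>: "\<And>z. Im z > 0 \<Longrightarrow> Im (\<phi> z) > 0"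
    and C: "\<And>z. Im z > 0 \<Longrightarrow> Im z \<le> C * Im (\<phi> z)" and f: "f \<in> hardy2"
  shows "f \<circ> \<phi> \<in> hardy2" and "hardy2_norm (f \<circ> \<phi>) \<le> sqrt C * hardy2_norm f"
proof -
  have "C * Im (\<phi> \<i>) > 0" using C[of \<i>] by simp
  then have C0: "C > 0" using \<phi>[of \<i>] by (simp add: zero_less_mult_iff)
  obtain G :: "real \<Rightarrow> complex" where G: "G \<in> L2" and nt: "AE x in lborel. (f \<longlongrightarrow> G x) (nontangential x)"
    and P: "\<And>z. Im z > 0 \<Longrightarrow> f z = (LINT t|lborel. poisson z t * G t)"
    by (rule hardy2_boundary_function[OF f]) blast
  note [measurable] = L2_measurable[OF G]
  have fp: "(f \<circ> \<phi>) holomorphic_on upper_half_plane"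
    by (rule holomorphic_on_compose_gen[OF hol hardy2_holomorphic[OF f]])
       (auto simp: upper_half_plane_def \<phi>)
  have CG: "C * sqnorm G \<ge> 0" using C0 sqnorm_nonneg by simp
  have le: "(\<integral>\<^sup>+x. ennreal ((cmod (slice (f \<circ> \<phi>) y x))\<^sup>2) \<partial>lborel) \<le> ennreal (C * sqnorm G)" if y: "y > 0" for y
  proof -
    note [measurable] = slice_measurable[OF hol y]
    have w: "Im (\<phi> (Complex x y)) > 0" for x using y by (intro \<phi>) simp
    have "(\<integral>\<^sup>+x. ennreal ((cmod (slice (f \<circ> \<phi>) y x))\<^sup>2) \<partial>lborel)
        \<le> (\<integral>\<^sup>+x. (\<integral>\<^sup>+t. ennreal (poisson (slice \<phi> y x) t) * ennreal ((cmod (G t))\<^sup>2) \<partial>lborel) \<partial>lborel)"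
    proof (intro nn_integral_mono)
      fix x
      let ?w = "\<phi> (Complex x y)"
      have "ennreal ((cmod (slice (f \<circ> \<phi>) y x))\<^sup>2) \<le> ennreal (LINT t|lborel. poisson ?w t * (cmod (G t))\<^sup>2)"
        using poisson_L2_jensen[OF G w[of x]] P[OF w[of x]] by (simp add: slice_def ennreal_leI)
      also have "\<dots> = (\<integral>\<^sup>+t. ennreal (poisson ?w t * (cmod (G t))\<^sup>2) \<partial>lborel)"
        using poisson_nonneg[OF w[of x]]
        by (intro nn_integral_eq_integral[symmetric] poisson_L2_integrable[OF G w]) auto
      also have "\<dots> = (\<integral>\<^sup>+t. ennreal (poisson ?w t) * ennreal ((cmod (G t))\<^sup>2) \<partial>lborel)"
        using poisson_nonneg[OF w[of x]] by (intro nn_integral_cong ennreal_mult) auto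
      finally show "ennreal ((cmod (slice (f \<circ> \<phi>) y x))\<^sup>2)
          \<le> (\<integral>\<^sup>+t. ennreal (poisson (slice \<phi> y x) t) * ennreal ((cmod (G t))\<^sup>2) \<partial>lborel)"
        by (simp add: slice_def)
    qed
    also have "\<dots> = (\<integral>\<^sup>+t. (\<integral>\<^sup>+x. ennreal (poisson (slice \<phi> y x) t) * ennreal ((cmod (G t))\<^sup>2) \<partial>lborel) \<partial>lborel)"
      unfolding poisson_def by (rule lborel_pair.Fubini') measurable
    also have "\<dots> = (\<integral>\<^sup>+t. (\<integral>\<^sup>+x. ennreal (poisson (slice \<phi> y x) t) \<partial>lborel) * ennreal ((cmod (G t))\<^sup>2) \<partial>lborel)"
      unfolding poisson_def by (intro nn_integral_cong nn_integral_multc) measurable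
    also have "\<dots> \<le> (\<integral>\<^sup>+t. ennreal C * ennreal ((cmod (G t))\<^sup>2) \<partial>lborel)"
      unfolding slice_def
      by (intro nn_integral_mono mult_right_mono nn_integral_poisson_composed[OF hol \<phi> C y]) auto
    also have "\<dots> = ennreal (C * sqnorm G)"
      using C0 by (simp add: nn_integral_cmult nn_integral_eq_sqnorm[OF G] ennreal_mult sqnorm_nonneg)
    finally show ?thesis .
  qed
  show comp: "f \<circ> \<phi> \<in> hardy2"
    using fp le CG by (auto simp: hardy2_iff)
  obtain K :: "real \<Rightarrow> complex" where K: "K \<in> L2" and Knt: "AE x in lborel. ((f \<circ> \<phi>) \<longlongrightarrow> K x) (nontangential x)"
    and KM: "\<And>M. (\<And>y. y > 0 \<Longrightarrow> sqnorm (slice (f \<circ> \<phi>) y) \<le> M) \<Longrightarrow> sqnorm K \<le> M"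
    by (rule hardy2_boundary_function[OF comp]) blast
  have "sqnorm K \<le> C * sqnorm G"
    by (intro KM L2I(2)[OF slice_measurable[OF fp] le CG])
  then have "sqrt (sqnorm K) \<le> sqrt (C * sqnorm G)" by (rule real_sqrt_le_mono)
  then show "hardy2_norm (f \<circ> \<phi>) \<le> sqrt C * hardy2_norm f"
    by (simp add: hardy2_norm_eq[OF K Knt] hardy2_norm_eq[OF G nt] real_sqrt_mult)
qed

lemma bounded_Im_ratio_imp_bounded_composition:
  assumes hol: "\<phi> holomorphic_on upper_half_plane" and \<phi>: "\<phi> ` upper_half_plane \<subseteq> upper_half_plane"
    and bdd: "bdd_above ((\<lambda>z. Im z / Im (\<phi> z)) ` upper_half_plane)"
  shows "bounded_composition chi \<phi>"
proof -
  obtain C where C: "\<And>z. z \<in> upper_half_plane \<Longrightarrow> Im z / Im (\<phi> z) \<le> C"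
    using bdd by (auto simp: bdd_above_def)
  have pos: "Im (\<phi> z) > 0" if "Im z > 0" for z
    using \<phi> that by (auto simp: upper_half_plane_def)
  have C': "Im z \<le> C * Im (\<phi> z)" if "Im z > 0" for z
    using C[of z] pos[OF that] that by (simp add: upper_half_plane_def field_simps)
  show ?thesis
    unfolding bounded_composition_def model_space_def
    using hardy2_composition[OF hol pos C'] by blast
qed

theorem theorem3p1:
  fixes chi \<phi> :: "complex \<Rightarrow> complex"
  assumes "inner_function chi"
    and "\<phi> holomorphic_on upper_half_plane"
    and "\<phi> ` upper_half_plane \<subseteq> upper_half_plane"
  shows "(bounded_composition chi \<phi> \<longrightarrow>
            bdd_above ((\<lambda>z. Im z / Im (\<phi> z) * (1 - (cmod (chi (\<phi> z)))\<^sup>2)) ` upper_half_plane))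
       \<and> (bdd_above ((\<lambda>z. Im z / Im (\<phi> z)) ` upper_half_plane) \<longrightarrow>
            bounded_composition chi \<phi>)
       \<and> ((SUP z\<in>upper_half_plane. cmod (chi (\<phi> z))) < 1 \<longrightarrow>
            (bounded_composition chi \<phi> \<longleftrightarrow>
             bdd_above ((\<lambda>z. Im z / Im (\<phi> z)) ` upper_half_plane)))"
proof -
  have 1: "bdd_above ((\<lambda>z. Im z / Im (\<phi> z) * (1 - (cmod (chi (\<phi> z)))\<^sup>2)) ` upper_half_plane)"
    if "bounded_composition chi \<phi>"
    by (rule bounded_composition_imp_kernel_ratio_bounded[OF assms(1,3) that])
  have 2: "bounded_composition chi \<phi>" if "bdd_above ((\<lambda>z. Im z / Im (\<phi> z)) ` upper_half_plane)"
    by (rule bounded_Im_ratio_imp_bounded_composition[OF assms(2,3) that])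
  have 3: "bdd_above ((\<lambda>z. Im z / Im (\<phi> z)) ` upper_half_plane)"
    if bc: "bounded_composition chi \<phi>" and sup: "(SUP z\<in>upper_half_plane. cmod (chi (\<phi> z))) < 1"
  proof -
    define s where "s = (SUP z\<in>upper_half_plane. cmod (chi (\<phi> z)))"
    have le1: "cmod (chi (\<phi> z)) \<le> 1" if "z \<in> upper_half_plane" for z
      using assms(1,3) that by (auto simp: inner_function_def)
    then have bdd: "bdd_above ((\<lambda>z. cmod (chi (\<phi> z))) ` upper_half_plane)"
      by (intro bdd_aboveI2[where M=1])
    have s: "cmod (chi (\<phi> z)) \<le> s" if "z \<in> upper_half_plane" for z
      unfolding s_def using that bdd by (intro cSUP_upper)
    have i: "\<i> \<in> upper_half_plane" by (simp add: upper_half_plane_def)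
    have s0: "s \<ge> 0" using s[OF i] norm_ge_zero order_trans by blast
    have s1: "1 - s\<^sup>2 > 0" using sup s0 by (simp add: s_def[symmetric] abs_square_less_1)
    obtain C where C: "\<And>z. z \<in> upper_half_plane \<Longrightarrow> Im z / Im (\<phi> z) * (1 - (cmod (chi (\<phi> z)))\<^sup>2) \<le> C"
      using 1[OF bc] by (auto simp: bdd_above_def)
    have "Im z / Im (\<phi> z) \<le> C / (1 - s\<^sup>2)" if z: "z \<in> upper_half_plane" for z
    proof -
      have "Im z / Im (\<phi> z) \<ge> 0" using z assms(3) by (auto simp: upper_half_plane_def intro!: divide_nonneg_nonneg less_imp_le)
      moreover have "(cmod (chi (\<phi> z)))\<^sup>2 \<le> s\<^sup>2" using s[OF z] by (intro power_mono) auto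
      ultimately have "Im z / Im (\<phi> z) * (1 - s\<^sup>2) \<le> Im z / Im (\<phi> z) * (1 - (cmod (chi (\<phi> z)))\<^sup>2)"
        by (intro mult_left_mono) auto
      also have "\<dots> \<le> C" by (rule C[OF z])
      finally show ?thesis using s1 by (simp add: pos_le_divide_eq)
    qed
    then show ?thesis by (intro bdd_aboveI2)
  qed
  show ?thesis by (intro conjI impI iffI; (rule 1 | rule 2 | rule 3); assumption)
qed

end
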